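(* Let $(K;\mathcal{T})$ be a triangulated 3-dimensional pseudo-manifold (with or without boundary) and let $(0,\kappa)$ be prescribed area-curvature functions (with area function identically $0$). Then the following are equivalent: (1) $(K;\mathcal{T})$ admits an angle structure with area-curvature $(0,\kappa)$; (2) $\chi^*(s)<\chi^{(0,\kappa)}(s)$ for all $s\in C(K;\mathcal{T})$ with all quadrilateral coordinates non-negative and at least one quadrilateral coordinate positive; (3) $\chi(S)=\chi^{(0,\kappa)}(\overline{S})$ for each vertex linking normal surface $S$, and for all $s\in PC(K;\mathcal{T})$ with at least one quadrilateral coordinate positive, one has $\chi^*(s)<\chi^{(0,\kappa)}(s)$; (4) $\chi(S)=\chi^{(0,\kappa)}(\overline{S})$ for each vertex linking normal surface $S$, and for all vertex solutions $V_i$ with at least one quadrilateral coordinate positive, one has $\chi^*(V_i)<\chi^{(0,\kappa)}(V_i)$.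
   Context: **Pseudo-manifolds.** Let $X$ be a disjoint union of compact 3-simplices $\sigma^3_1,\dots,\sigma^3_t$ and $\Phi=\{\phi_1,\dots,\phi_r\}$ a collection of affine isomorphisms $\phi_i:\tau_i\to\delta_i$ between distinct codimension-one faces of the simplices, with $\{\tau_i,\delta_i\}\cap\{\tau_j,\delta_j\}=\emptyset$ for $i\ne j$. The quotient $K=X/\Phi$ is a compact 3-dimensional pseudo-manifold and the images of the simplices and their sub-simplices form its triangulation $\mathcal{T}$, with cells called vertices, edges, triangles, tetrahedra. It has boundary (the images of unpaired faces) if some face is unpaired; otherwise it is closed. Let $e_1,\dots,e_n$ be the edges. **Normal disc types.** A normal disc in a tetrahedron is a properly embedded disc meeting each face in one normal arc (a properly embedded arc joining the interiors of two distinct edges of the face) or not at all. Up to normal isotopy (isotopy preserving each cell) each tetrahedron has four normal triangle types (each cutting off a corner and meeting the three edges there) and three normal quadrilateral types (each separating a pair of opposite edges and meeting the other four edges). A quadrilateral type faces the two edges of its tetrahedron disjoint from it. Let $N_\square=\{q_1,\dots,q_{3t}\}$ and $N_\Delta=\{p_1,\dots,p_{4t}\}$ be the sets of all quadrilateral and triangle types in $\mathcal{T}$. Identify these types with the standard basis vectors of $\mathbb{R}^{7t}$ (quadrilaterals first). For a normal surface $S$ (a compact surface whose preimage in $X$ is a finite collection of normal discs), its normal coordinate $\overline{S}\in\mathbb{R}^{7t}$ counts the discs of each type. The vertex linking normal surface of a vertex of $\mathcal{T}$ is the normal surface consisting of exactly one normal triangle for each tetrahedron corner at that vertex; $\chi(S)$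 is the usual Euler characteristic. **Solution spaces.** $C(K;\mathcal{T})\subset\mathbb{R}^{7t}$ is the vector space of all $(x_1,\dots,x_{3t},y_1,\dots,y_{4t})$ satisfying, for each pairing $\phi:\tau\to\delta$ in $\Phi$ (with $\tau\subset\sigma^3_i$, $\delta\subset\sigma^3_j$) and each normal arc type in the resulting triangle, $x_q+y_p=x_{q'}+y_{p'}$, where $q,p$ are the quadrilateral and triangle types in $\sigma^3_i$ meeting $\tau$ in that arc type and $q',p'$ those in $\sigma^3_j$ meeting $\delta$ in that arc type. The $x_i$ are the quadrilateral coordinates. $PC(K;\mathcal{T})$ is the convex polytope $C(K;\mathcal{T})\cap\{x\in\mathbb{R}^{7t}:x_i\ge0,\ \sum_{i=1}^{7t}x_i=1\}$ and the vertex solutions $V_1,\dots,V_m$ are its vertices. For each tetrahedron $\sigma^3$, $W_{\sigma^3}$ is the sum of its four triangle types minus the sum of its three quadrilateral types. For each edge $e$ of degree $k$ (formed by gluing $k$ edges $\tilde e_1,\dots,\tilde e_k$ of the unglued tetrahedra), $W_e=\sum_{i=1}^k(p_{s_i}+p_{r_i}-q_{l_i})$, where in the tetrahedron containing $\tilde e_i$, $q_{l_i}$ is the quadrilateral type disjoint from $\tilde e_i$ and $p_{s_i},p_{r_i}$ are the two triangle types meeting $\tilde e_i$. By a theorem of Kang and Rubinstein, $W_{\sigma^3_1},\dots,W_{\sigma^3_t},W_{e_1},\dots,W_{e_n}$ is a basis of $C(K;\mathcal{T})$. **Generalised Euler characteristic.** $\chi^*:\mathbb{R}^{7t}\to\mathbb{R}$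 is the linear function $\chi^*(x,y)=\sum_i x_i\chi^*(q_i)+\sum_j y_j\chi^*(p_j)$, where, with $d(e)$ the degree of $e$ and $b(D)$ the number of normal arcs in $D\cap\partial K$, $\chi^*(p)=-\tfrac12(1+b(p))+\sum_{a=0}^2\tfrac1{d(e_a)}$ for a triangle type meeting edges $e_0,e_1,e_2$ (with multiplicity) and $\chi^*(q)=-\tfrac12(2+b(q))+\sum_{a=0}^3\tfrac1{d(e_a)}$ for a quadrilateral type meeting edges $e_0,\dots,e_3$ (with multiplicity). **Angle structures with area-curvature $(0,\kappa)$.** A quadrilateral disc separates the interior of a 3-simplex into two wedges; up to normal isotopy there are six wedges in each 3-simplex, one for each edge of it. A generalised angle structure on $(K;\mathcal{T})$ is a real-valued function on the set of all wedges (of all tetrahedra). The combinatorial area of a triangle type is the sum of the angles of the three wedges at the three edges it meets, minus $\pi$. The curvature at an edge $e$ is $2\pi$ (if the interior of $e$ lies in the interior of $K$) or $\pi$ (if $e\subset\partial K$) minus the sum of the angles of all wedges containing $e$. Here $\kappa:\{\text{edges}\}\to\mathbb{R}$ is a given function. An angle structure with area-curvature $(0,\kappa)$ is a generalised angle structure with all angles positive, with area $0$ for every normal triangle type and with curvature $\kappa(e)$ at each edge $e$. **The function $\chi^{(0,\kappa)}$.** It is the linear function on $C(K;\mathcal{T})$ given, for $s=\sum_{i=1}^t w_iW_{\sigma^3_i}+\sum_{j=1}^n z_jW_{e_j}$, by $\chi^{(0,\kappa)}(s)=\frac1{2\pi}\sum_{j=1}^n 2z_j\kappa(e_j)$.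
   Formalization: The formal theorem additionally assumes that no edge of the triangulation is identified with itself in reverse; with such an edge, (1) can hold while (3) and (4) fail, because the Euler characteristic of its vertex link is then smaller than χ* of its normal coordinate. *)

theory Defs
  imports "HOL-Analysis.Analysis"
begin

text \<open>
  The type \<open>'t\<close> enumerates the tetrahedra (so \<open>t = CARD('t) \<ge> 1\<close>), and the vertices of every
  tetrahedron are labelled by the four elements of the type \<open>4\<close>.  A subset \<open>S\<close> of \<open>4\<close> stands for
  the sub-simplex spanned by \<open>S\<close>, and the face opposite the vertex \<open>v\<close> of the tetrahedron \<open>\<sigma>\<close> is
  written \<open>(\<sigma>, v)\<close>.

  An affine isomorphism of faces is determined by its bijection of vertices.  That bijection
  extends uniquely to a permutation \<open>vmap\<close> of all four labels, which sends the vertex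
  opposite the domain face to the vertex opposite the target face.
\<close>

datatype 't pairing =
  Pairing (tet_dom: 't) (opp_dom: 4) (tet_cod: 't) (vmap: "4 \<Rightarrow> 4")

definition dom_face :: "'t pairing \<Rightarrow> 't \<times> 4" where
  "dom_face \<phi> = (tet_dom \<phi>, opp_dom \<phi>)"

definition cod_face :: "'t pairing \<Rightarrow> 't \<times> 4" where
  "cod_face \<phi> = (tet_cod \<phi>, vmap \<phi> (opp_dom \<phi>))"

definition unpaired_faces :: "'t pairing set \<Rightarrow> ('t \<times> 4) set" where
  "unpaired_faces \<Phi> = - (\<Union>\<phi>\<in>\<Phi>. {dom_face \<phi>, cod_face \<phi>})"

text \<open>Sub-simplices of the disjoint union \<open>X\<close>, and when they have the same image in \<open>K = X/\<Phi>\<close>.\<close>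

definition cell_glue :: "'t pairing set \<Rightarrow> (('t \<times> 4 set) \<times> ('t \<times> 4 set)) set" where
  "cell_glue \<Phi> =
     {((tet_dom \<phi>, S), (tet_cod \<phi>, vmap \<phi> ` S)) | \<phi> S. \<phi> \<in> \<Phi> \<and> opp_dom \<phi> \<notin> S}"

definition cell_ident :: "'t pairing set \<Rightarrow> (('t \<times> 4 set) \<times> ('t \<times> 4 set)) set" where
  "cell_ident \<Phi> = (cell_glue \<Phi> \<union> (cell_glue \<Phi>)\<inverse>)\<^sup>*"

text \<open>A vertex or edge of the triangulation is represented by the set of its preimages in \<open>X\<close>.\<close>

definition vertices :: "'t pairing set \<Rightarrow> ('t \<times> 4 set) set set" where
  "vertices \<Phi> = {(\<sigma>, S). card S = 1} // cell_ident \<Phi>"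

definition edges :: "'t pairing set \<Rightarrow> ('t \<times> 4 set) set set" where
  "edges \<Phi> = {(\<sigma>, E). card E = 2} // cell_ident \<Phi>"

definition edge_class :: "'t pairing set \<Rightarrow> 't \<Rightarrow> 4 set \<Rightarrow> ('t \<times> 4 set) set" where
  "edge_class \<Phi> \<sigma> E = cell_ident \<Phi> `` {(\<sigma>, E)}"

definition degree :: "('t \<times> 4 set) set \<Rightarrow> nat" where
  "degree e = card e"

definition boundary_edge :: "'t pairing set \<Rightarrow> ('t \<times> 4 set) set \<Rightarrow> bool" where
  "boundary_edge \<Phi> e \<longleftrightarrow> (\<exists>(\<sigma>, E)\<in>e. \<exists>v. v \<notin> E \<and> (\<sigma>, v) \<in> unpaired_faces \<Phi>)"

text \<open>
  A flag \<open>(\<sigma>, a, S)\<close> with \<open>a \<in> S\<close> is the sub-simplex \<open>S\<close> of \<open>\<sigma>\<close> together with one of its corners.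
  If \<open>card S = 2\<close> it is an end of an edge, equivalently a point of the normal triangle cutting off
  \<open>a\<close> on that edge or an orientation of the edge; if \<open>card S = 3\<close> it is the normal arc in the
  triangle \<open>S\<close> cutting off \<open>a\<close>.
\<close>

definition flag_glue :: "'t pairing set \<Rightarrow> (('t \<times> 4 \<times> 4 set) \<times> ('t \<times> 4 \<times> 4 set)) set" where
  "flag_glue \<Phi> = {((tet_dom \<phi>, a, S), (tet_cod \<phi>, vmap \<phi> a, vmap \<phi> ` S)) | \<phi> a S.
      \<phi> \<in> \<Phi> \<and> a \<in> S \<and> opp_dom \<phi> \<notin> S}"

definition flag_ident :: "'t pairing set \<Rightarrow> (('t \<times> 4 \<times> 4 set) \<times> ('t \<times> 4 \<times> 4 set)) set" where
  "flag_ident \<Phi> = (flag_glue \<Phi> \<union> (flag_glue \<Phi>)\<inverse>)\<^sup>*"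

text \<open>
  The last condition says that no edge is identified with itself in reverse.  Otherwise the image
  of that edge in \<open>K\<close> is folded in half, hence not a 1-cell, and the image of its midpoint has the
  cone over a projective plane as a neighbourhood.
\<close>

definition triangulated_pseudomanifold :: "'t pairing set \<Rightarrow> bool" where
  "triangulated_pseudomanifold \<Phi> \<longleftrightarrow>
     (\<forall>\<phi>\<in>\<Phi>. bij (vmap \<phi>) \<and> dom_face \<phi> \<noteq> cod_face \<phi>) \<and>
     (\<forall>\<phi>\<in>\<Phi>. \<forall>\<psi>\<in>\<Phi>. \<phi> \<noteq> \<psi> \<longrightarrow> {dom_face \<phi>, cod_face \<phi>} \<inter> {dom_face \<psi>, cod_face \<psi>} = {}) \<and>
     (\<forall>\<sigma> a b. a \<noteq> b \<longrightarrow> ((\<sigma>, a, {a, b}), (\<sigma>, b, {a, b})) \<notin> flag_ident \<Phi>)"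

text \<open>
  A quadrilateral type is named after the pair of opposite edges that it separates; these are the
  two edges disjoint from it.  A triangle type is given by the vertex that it cuts off.
\<close>

datatype quad = Q12_34 | Q13_24 | Q14_23

lemma UNIV_quad: "UNIV = {Q12_34, Q13_24, Q14_23}"
  using quad.exhaust by blast

instance quad :: finite
  by standard (simp add: UNIV_quad)

fun quad_edges :: "quad \<Rightarrow> 4 set set" where
  "quad_edges Q12_34 = {{1, 2}, {3, 4}}"
| "quad_edges Q13_24 = {{1, 3}, {2, 4}}"
| "quad_edges Q14_23 = {{1, 4}, {2, 3}}"

definition facing_quad :: "4 set \<Rightarrow> quad" where
  "facing_quad E = (THE q. E \<in> quad_edges q)"

type_synonym 't ndisc = "('t \<times> quad) + ('t \<times> 4)"

abbreviation Quad :: "'t \<Rightarrow> quad \<Rightarrow> 't ndisc" where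
  "Quad \<sigma> q \<equiv> Inl (\<sigma>, q)"

abbreviation Tri :: "'t \<Rightarrow> 4 \<Rightarrow> 't ndisc" where
  "Tri \<sigma> a \<equiv> Inr (\<sigma>, a)"

text \<open>
  In the face opposite \<open>v\<close>, the arc cutting off the vertex \<open>a\<close> is realised by the triangle at \<open>a\<close>
  and by the quadrilateral with \<open>a\<close> and \<open>v\<close> on the same side.
\<close>

definition matching_space :: "'t pairing set \<Rightarrow> (real ^ ('t::finite) ndisc) set" where
  "matching_space \<Phi> = {x. \<forall>\<phi>\<in>\<Phi>. \<forall>a. a \<noteq> opp_dom \<phi> \<longrightarrow>
     x $ Quad (tet_dom \<phi>) (facing_quad {opp_dom \<phi>, a}) + x $ Tri (tet_dom \<phi>) a =
     x $ Quad (tet_cod \<phi>) (facing_quad {vmap \<phi> (opp_dom \<phi>), vmap \<phi> a}) + x $ Tri (tet_cod \<phi>) (vmap \<phi> a)}"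

definition projective_solutions :: "'t pairing set \<Rightarrow> (real ^ ('t::finite) ndisc) set" where
  "projective_solutions \<Phi> =
     matching_space \<Phi> \<inter> {x. (\<forall>i. 0 \<le> x $ i) \<and> (\<Sum>i\<in>UNIV. x $ i) = 1}"

definition vertex_solutions :: "'t pairing set \<Rightarrow> (real ^ ('t::finite) ndisc) set" where
  "vertex_solutions \<Phi> = {V. V extreme_point_of projective_solutions \<Phi>}"

definition W_tet :: "'t \<Rightarrow> real ^ ('t::finite) ndisc" where
  "W_tet \<sigma> = (\<Sum>a\<in>UNIV. axis (Tri \<sigma> a) 1) - (\<Sum>q\<in>UNIV. axis (Quad \<sigma> q) 1)"

definition W_edge :: "('t \<times> 4 set) set \<Rightarrow> real ^ ('t::finite) ndisc" where
  "W_edge e = (\<Sum>(\<sigma>, E)\<in>e. (\<Sum>a\<in>E. axis (Tri \<sigma> a) 1) - axis (Quad \<sigma> (facing_quad E)) 1)"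

text \<open>
  The description below is unambiguous, and total on \<open>matching_space \<Phi>\<close>, because the vectors
  \<open>W_tet \<sigma>\<close> and \<open>W_edge e\<close> form a basis of that space (Kang and Rubinstein).
\<close>

definition chi_curv ::
  "'t pairing set \<Rightarrow> (('t \<times> 4 set) set \<Rightarrow> real) \<Rightarrow> real ^ ('t::finite) ndisc \<Rightarrow> real" where
  "chi_curv \<Phi> \<kappa> s = (THE r. \<exists>w z.
     s = (\<Sum>\<sigma>\<in>UNIV. w \<sigma> *\<^sub>R W_tet \<sigma>) + (\<Sum>e\<in>edges \<Phi>. z e *\<^sub>R W_edge e) \<and>
     r = 1 / (2 * pi) * (\<Sum>e\<in>edges \<Phi>. 2 * z e * \<kappa> e))"

text \<open>The sums over tetrahedron edges \<open>E\<close> count the edges met by a disc with multiplicity.\<close>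

fun chi_star_disc :: "'t pairing set \<Rightarrow> 't ndisc \<Rightarrow> real" where
  "chi_star_disc \<Phi> (Inl (\<sigma>, q)) =
     - 1 / 2 * (2 + real (card {v. (\<sigma>, v) \<in> unpaired_faces \<Phi>})) +
     (\<Sum>E | card E = 2 \<and> E \<notin> quad_edges q. 1 / real (degree (edge_class \<Phi> \<sigma> E)))"
| "chi_star_disc \<Phi> (Inr (\<sigma>, a)) =
     - 1 / 2 * (1 + real (card {v. v \<noteq> a \<and> (\<sigma>, v) \<in> unpaired_faces \<Phi>})) +
     (\<Sum>E | card E = 2 \<and> a \<in> E. 1 / real (degree (edge_class \<Phi> \<sigma> E)))"

definition chi_star :: "'t pairing set \<Rightarrow> real ^ ('t::finite) ndisc \<Rightarrow> real" where
  "chi_star \<Phi> s = (\<Sum>i\<in>UNIV. s $ i * chi_star_disc \<Phi> i)"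

text \<open>
  A vertex linking surface is given by its set of normal triangles.  Its Euler characteristic is
  that of the complex obtained from these triangles by the identifications induced by \<open>\<Phi>\<close>.
\<close>

definition vertex_link :: "('t \<times> 4 set) set \<Rightarrow> ('t \<times> 4) set" where
  "vertex_link v = {(\<sigma>, a). (\<sigma>, {a}) \<in> v}"

definition normal_coordinate :: "('t \<times> 4) set \<Rightarrow> real ^ ('t::finite) ndisc" where
  "normal_coordinate S = (\<Sum>(\<sigma>, a)\<in>S. axis (Tri \<sigma> a) 1)"

definition surface_points ::
  "'t pairing set \<Rightarrow> ('t \<times> 4) set \<Rightarrow> ('t \<times> 4 \<times> 4 set) set set" where
  "surface_points \<Phi> S = {(\<sigma>, a, E). (\<sigma>, a) \<in> S \<and> a \<in> E \<and> card E = 2} // flag_ident \<Phi>"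

definition surface_arcs ::
  "'t pairing set \<Rightarrow> ('t \<times> 4) set \<Rightarrow> ('t \<times> 4 \<times> 4 set) set set" where
  "surface_arcs \<Phi> S = {(\<sigma>, a, F). (\<sigma>, a) \<in> S \<and> a \<in> F \<and> card F = 3} // flag_ident \<Phi>"

definition euler_char :: "'t pairing set \<Rightarrow> ('t \<times> 4) set \<Rightarrow> int" where
  "euler_char \<Phi> S =
     int (card (surface_points \<Phi> S)) - int (card (surface_arcs \<Phi> S)) + int (card S)"

text \<open>
  The wedge of \<open>\<sigma>\<close> containing the tetrahedron edge \<open>E\<close> is written \<open>(\<sigma>, E)\<close>; values of an angle
  assignment on \<open>(\<sigma>, E)\<close> with \<open>card E \<noteq> 2\<close> are irrelevant.
\<close>

definition area :: "('t \<times> 4 set \<Rightarrow> real) \<Rightarrow> 't \<Rightarrow> 4 \<Rightarrow> real" where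
  "area \<alpha> \<sigma> a = (\<Sum>E | card E = 2 \<and> a \<in> E. \<alpha> (\<sigma>, E)) - pi"

definition curvature ::
  "'t pairing set \<Rightarrow> ('t \<times> 4 set \<Rightarrow> real) \<Rightarrow> ('t \<times> 4 set) set \<Rightarrow> real" where
  "curvature \<Phi> \<alpha> e = (if boundary_edge \<Phi> e then pi else 2 * pi) - (\<Sum>w\<in>e. \<alpha> w)"

definition angle_structure ::
  "'t pairing set \<Rightarrow> (('t \<times> 4 set) set \<Rightarrow> real) \<Rightarrow> ('t \<times> 4 set \<Rightarrow> real) \<Rightarrow> bool" where
  "angle_structure \<Phi> \<kappa> \<alpha> \<longleftrightarrow>
     (\<forall>\<sigma> E. card E = 2 \<longrightarrow> 0 < \<alpha> (\<sigma>, E)) \<and>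
     (\<forall>\<sigma> a. area \<alpha> \<sigma> a = 0) \<and>
     (\<forall>e\<in>edges \<Phi>. curvature \<Phi> \<alpha> e = \<kappa> e)"

end

theory Submission
  imports Defs
begin

text \<open>
  Write \<open>D = \<pi> (\<chi>\<^sup>* - \<chi>\<^sup>\<kappa>)\<close> (\<open>defect\<close>), a linear functional on the matching space.  If every normal triangle has
  area 0, then the three angles at each vertex of a tetrahedron add up to \<open>\<pi>\<close>, which forces the
  angles at opposite edges to agree.  An angle structure is therefore a positive function \<open>\<theta>\<close> on the
  quadrilateral types, \<open>\<theta> q\<close> being the angle at the two edges that \<open>q\<close> faces.  The combinatorial
  area of \<open>q\<close> is \<open>- 2 \<theta> q\<close>, and Gauss-Bonnet takes the form

    \<open>D s = - (\<Sum> q. \<theta> q * s q)\<close>,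

  a sum over quadrilateral types only.  On the basis vector \<open>W\<^sub>\<sigma>\<close> this equation says that the three
  angles in \<open>\<sigma>\<close> add up to \<open>\<pi>\<close>, and on \<open>W\<^sub>e\<close> it says that \<open>e\<close> has curvature \<open>\<kappa> e\<close>.  So the angle
  structures are exactly the positive \<open>\<theta>\<close> that represent \<open>D\<close> in this way
  (\<open>angle_structure_iff\<close>).  Such a \<open>\<theta>\<close> visibly makes \<open>D\<close> negative where the quadrilateral
  coordinates are non-negative and not all zero.  Conversely, if \<open>D\<close> is negative there, the
  quadrilateral parts of the vectors in the kernel of \<open>D\<close> form a subspace that misses the standard
  simplex, and a hyperplane separating the two yields \<open>\<theta>\<close> (\<open>positive_quad_angles\<close>).

  The vertex links enter because they span the solutions without quadrilaterals.  Their Euler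
  characteristic is \<open>\<chi>\<^sup>*\<close> of their normal coordinate (\<open>euler_char_vertex_link\<close>), so the condition on
  links says that \<open>D\<close> vanishes on those solutions.  Given this, a vector with non-negative
  quadrilateral coordinates can be moved into the cone over the polytope by adding links, without
  changing \<open>D\<close>; and on the polytope it is enough to look at the vertices, since \<open>D\<close> is linear and is
  0 at the vertices without quadrilaterals.

  Evaluating \<open>D\<close> on the basis needs two facts about the triangulation.  The coefficient of \<open>W\<^sub>e\<close> in a
  solution \<open>s\<close> is half the number of points in which \<open>s\<close> meets \<open>e\<close>; this makes the \<open>W\<^sub>\<sigma>\<close> and \<open>W\<^sub>e\<close> a
  basis (\<open>W_combination_exists\<close>, \<open>chi_curv_W_combination\<close>).  And the tetrahedra around an edge
  form a cycle, or a chain with exactly two free faces when the edge lies in the boundary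
  (\<open>sum_card_unpaired_sides\<close>), whence \<open>\<chi>\<^sup>*\<close> takes the value 2 or 1 on \<open>W\<^sub>e\<close>
  (\<open>chi_star_W_combination\<close>).
\<close>

section \<open>Edges and quadrilaterals of a single tetrahedron\<close>

text \<open>
  The four labels are treated symmetrically below: computations in a tetrahedron are carried out for
  an arbitrary ordering \<open>a, b, c, d\<close> of its vertices, so that one formula serves all edges and faces.
\<close>

lemma facing_quad_simps:
  "facing_quad {1, 2} = Q12_34" "facing_quad {3, 4} = Q12_34"
  "facing_quad {1, 3} = Q13_24" "facing_quad {2, 4} = Q13_24"
  "facing_quad {1, 4} = Q14_23" "facing_quad {2, 3} = Q14_23"
proof -
  have *: "facing_quad E = q" if "E \<in> quad_edges q" "\<And>q'. E \<in> quad_edges q' \<Longrightarrow> q' = q" for E q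
    unfolding facing_quad_def using that by (rule the_equality)
  have **: "E \<in> quad_edges q \<longleftrightarrow> (case q of Q12_34 \<Rightarrow> E \<in> {{1, 2}, {3, 4}}
    | Q13_24 \<Rightarrow> E \<in> {{1, 3}, {2, 4}} | Q14_23 \<Rightarrow> E \<in> {{1, 4}, {2, 3}})" for E q
    by (cases q) simp_all
  show "facing_quad {1, 2} = Q12_34" "facing_quad {3, 4} = Q12_34"
    "facing_quad {1, 3} = Q13_24" "facing_quad {2, 4} = Q13_24"
    "facing_quad {1, 4} = Q14_23" "facing_quad {2, 3} = Q14_23"
    by (rule *; simp add: doubleton_eq_iff ** split: quad.splits)+
qed

lemma UNIV_labels:
  assumes "distinct [a, b, c, d :: 4]"
  shows "UNIV = {a, b, c, d}"
proof -
  have "card {a, b, c, d} = CARD(4)" using assms by simp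
  then show ?thesis by (metis card_subset_eq finite subset_UNIV)
qed

lemma labels_extend:
  assumes "a \<noteq> (b :: 4)"
  obtains c d where "distinct [a, b, c, d]"
proof -
  have "card (- {a, b}) = 2" using assms by (simp add: Compl_eq_Diff_UNIV card_Diff_subset)
  then obtain c d where "- {a, b} = {c, d}" "c \<noteq> d" by (auto simp: card_2_iff)
  then have "distinct [a, b, c, d]" using assms by auto
  then show thesis by (rule that)
qed

lemma labels_extend3:
  assumes "distinct [a, b, c :: 4]"
  obtains d where "distinct [a, b, c, d]"
proof -
  have "card (- {a, b, c}) = 1" using assms by (simp add: Compl_eq_Diff_UNIV card_Diff_subset)
  then obtain d where "- {a, b, c} = {d}" by (rule card_1_singletonE)
  then have "distinct [a, b, c, d]" using assms by auto
  then show thesis by (rule that)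
qed

lemma pair_labels:
  assumes "card (E :: 4 set) = 2"
  obtains a b c d where "E = {a, b}" "distinct [a, b, c, d]"
proof -
  obtain a b where "E = {a, b}" "a \<noteq> b" using assms by (auto simp: card_2_iff)
  with labels_extend[of a b] show thesis using that by metis
qed

lemma pairs_labels:
  assumes "distinct [a, b, c, d :: 4]"
  shows "{E. card E = 2} = {{a, b}, {a, c}, {a, d}, {b, c}, {b, d}, {c, d}}" (is "?L = ?R")
proof
  show "?L \<subseteq> ?R"
  proof
    fix E assume "E \<in> ?L"
    then obtain x y where E: "E = {x, y}" "x \<noteq> y" by (auto simp: card_2_iff)
    have "x \<in> {a, b, c, d}" "y \<in> {a, b, c, d}" using UNIV_labels[OF assms] by auto
    with E show "E \<in> ?R" by (elim insertE emptyE) (simp_all add: doubleton_eq_iff)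
  qed
  show "?R \<subseteq> ?L" using assms by simp
qed

lemma sum_pairs:
  fixes f :: "4 set \<Rightarrow> real"
  assumes "distinct [a, b, c, d]"
  shows "(\<Sum>E | card E = 2. f E) = f {a, b} + f {a, c} + f {a, d} + f {b, c} + f {b, d} + f {c, d}"
  unfolding pairs_labels[OF assms] using assms by (simp add: doubleton_eq_iff)

lemma sum_pairs_through:
  fixes f :: "4 set \<Rightarrow> real"
  assumes "distinct [a, b, c, d]"
  shows "(\<Sum>E | card E = 2 \<and> a \<in> E. f E) = f {a, b} + f {a, c} + f {a, d}"
proof -
  have "{E. card E = 2 \<and> a \<in> E} = {E. card E = 2} \<inter> {E. a \<in> E}" by auto
  also have "\<dots> = {{a, b}, {a, c}, {a, d}}"
    unfolding pairs_labels[OF assms] using assms by auto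
  finally have *: "{E. card E = 2 \<and> a \<in> E} = {{a, b}, {a, c}, {a, d}}" .
  show ?thesis unfolding * using assms by (simp add: doubleton_eq_iff)
qed

lemma facing_quad_labels:
  assumes "distinct [a, b, c, d :: 4]"
  shows "facing_quad {c, d} = facing_quad {a, b}"
    and "facing_quad {a, b} \<noteq> facing_quad {a, c}"
    and "quad_edges (facing_quad {a, b}) = {{a, b}, {c, d}}"
proof -
  have "facing_quad {c, d} = facing_quad {a, b} \<and> facing_quad {a, b} \<noteq> facing_quad {a, c} \<and>
    quad_edges (facing_quad {a, b}) = {{a, b}, {c, d}}"
    using assms exhaust_4[of a] exhaust_4[of b] exhaust_4[of c] exhaust_4[of d]
    by (elim disjE, simp_all only: distinct.simps list.set insert_iff simp_thms empty_iff)
      (simp_all add: facing_quad_simps insert_commute)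
  then show "facing_quad {c, d} = facing_quad {a, b}"
    "facing_quad {a, b} \<noteq> facing_quad {a, c}"
    "quad_edges (facing_quad {a, b}) = {{a, b}, {c, d}}" by blast+
qed

lemma UNIV_quad_labels:
  assumes "distinct [a, b, c, d :: 4]"
  shows "UNIV = {facing_quad {a, b}, facing_quad {a, c}, facing_quad {a, d}}"
    and "distinct [facing_quad {a, b}, facing_quad {a, c}, facing_quad {a, d}]"
proof -
  show *: "distinct [facing_quad {a, b}, facing_quad {a, c}, facing_quad {a, d}]"
    using facing_quad_labels(2)[of a b c d] facing_quad_labels(2)[of a b d c]
      facing_quad_labels(2)[of a c d b] assms by auto
  then have "card {facing_quad {a, b}, facing_quad {a, c}, facing_quad {a, d}} = CARD(quad)"
    by (simp add: UNIV_quad)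
  then show "UNIV = {facing_quad {a, b}, facing_quad {a, c}, facing_quad {a, d}}"
    by (metis card_subset_eq finite subset_UNIV)
qed

lemma sum_quads:
  fixes f :: "quad \<Rightarrow> real"
  assumes "distinct [a, b, c, d]"
  shows "(\<Sum>q\<in>UNIV. f q) = f (facing_quad {a, b}) + f (facing_quad {a, c}) + f (facing_quad {a, d})"
  unfolding UNIV_quad_labels(1)[OF assms] using UNIV_quad_labels(2)[OF assms] by simp

lemma sum_labels:
  fixes f :: "4 \<Rightarrow> real"
  assumes "distinct [a, b, c, d]"
  shows "(\<Sum>a\<in>UNIV. f a) = f a + f b + f c + f d"
  unfolding UNIV_labels[OF assms] using assms by simp

lemma quad_edges_iff: "E \<in> quad_edges q \<longleftrightarrow> card E = 2 \<and> facing_quad E = q"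
proof
  assume "E \<in> quad_edges q"
  then show "card E = 2 \<and> facing_quad E = q" by (cases q) (auto simp: facing_quad_simps)
next
  assume *: "card E = 2 \<and> facing_quad E = q"
  then obtain a b c d where E: "E = {a, b}" and "distinct [a, b, c, d]"
    using pair_labels[of E] by metis
  then have "quad_edges (facing_quad E) = {{a, b}, {c, d}}"
    using facing_quad_labels(3) by blast
  with * E show "E \<in> quad_edges q" by blast
qed

lemma quad_labels:
  obtains a b c d where "q = facing_quad {a, b}" "distinct [a, b, c, d :: 4]"
proof (cases q)
  case Q12_34 then show ?thesis using that[of 1 2 3 4] by (simp add: facing_quad_simps)
next
  case Q13_24 then show ?thesis using that[of 1 3 2 4] by (simp add: facing_quad_simps)
next
  case Q14_23 then show ?thesis using that[of 1 4 2 3] by (simp add: facing_quad_simps)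
qed

section \<open>Edge weights and the matching equations\<close>

text \<open>
  The number of points in which a normal surface with coordinate \<open>s\<close> meets the edge \<open>E\<close> of \<open>\<sigma>\<close>.
\<close>

definition edge_weight :: "real ^ ('t::finite) ndisc \<Rightarrow> 't \<times> 4 set \<Rightarrow> real" where
  "edge_weight s = (\<lambda>(\<sigma>, E). (\<Sum>a\<in>E. s $ Tri \<sigma> a) + (\<Sum>q\<in>-{facing_quad E}. s $ Quad \<sigma> q))"

text \<open>
  The combination of the vectors \<open>W\<^sub>\<sigma>\<close> and \<open>W\<^sub>e\<close> in which the copies of an edge in different
  tetrahedra may carry different coefficients.  This decouples the tetrahedra: finding coefficients
  becomes a system of seven equations in seven unknowns in each of them, and gluing only requires
  the coefficients to be constant on edge classes.
\<close>

definition local_combination :: "('t \<Rightarrow> real) \<Rightarrow> ('t \<times> 4 set \<Rightarrow> real) \<Rightarrow> real ^ ('t::finite) ndisc" where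
  "local_combination w Z = (\<chi> i. case i of
     Inl (\<sigma>, q) \<Rightarrow> - w \<sigma> - (\<Sum>E\<in>quad_edges q. Z (\<sigma>, E))
   | Inr (\<sigma>, a) \<Rightarrow> w \<sigma> + (\<Sum>E | card E = 2 \<and> a \<in> E. Z (\<sigma>, E)))"

lemma edge_weight_labels:
  assumes "distinct [a, b, c, d]"
  shows "edge_weight s (\<sigma>, {a, b}) = s $ Tri \<sigma> a + s $ Tri \<sigma> b +
    s $ Quad \<sigma> (facing_quad {a, c}) + s $ Quad \<sigma> (facing_quad {a, d})"
proof -
  have "- {facing_quad {a, b}} = {facing_quad {a, c}, facing_quad {a, d}}"
    using UNIV_quad_labels[OF assms] by auto
  then show ?thesis using UNIV_quad_labels(2)[OF assms] assms by (simp add: edge_weight_def)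
qed

lemma local_combination_Tri:
  assumes "distinct [a, b, c, d]"
  shows "local_combination w Z $ Tri \<sigma> a = w \<sigma> + Z (\<sigma>, {a, b}) + Z (\<sigma>, {a, c}) + Z (\<sigma>, {a, d})"
  using sum_pairs_through[OF assms, of "\<lambda>E. Z (\<sigma>, E)"] by (simp add: local_combination_def)

lemma local_combination_Quad:
  assumes "distinct [a, b, c, d]"
  shows "local_combination w Z $ Quad \<sigma> (facing_quad {a, b}) = - w \<sigma> - Z (\<sigma>, {a, b}) - Z (\<sigma>, {c, d})"
  using facing_quad_labels(3)[OF assms] assms by (simp add: local_combination_def doubleton_eq_iff)

text \<open>
  Only the coefficient of \<open>E\<close> itself survives, through the triangles at its two ends.  An edge
  sharing one vertex with \<open>E\<close> contributes a triangle and, with the opposite sign, a quadrilateral, both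
  meeting \<open>E\<close> once; the discs of the opposite edge miss \<open>E\<close>; and of the discs in \<open>W\<^sub>\<sigma>\<close> two triangles
  and two quadrilaterals meet \<open>E\<close>, with opposite signs.
\<close>

lemma edge_weight_local_combination:
  assumes "card E = 2"
  shows "edge_weight (local_combination w Z) (\<sigma>, E) = 2 * Z (\<sigma>, E)"
proof -
  obtain a b c d where E: "E = {a, b}" and d: "distinct [a, b, c, d]"
    using assms by (rule pair_labels)
  have d': "distinct [b, a, c, d]" "distinct [a, c, b, d]" "distinct [a, d, b, c]" using d by auto
  show ?thesis
    unfolding E edge_weight_labels[OF d] local_combination_Tri[OF d] local_combination_Tri[OF d'(1)]
      local_combination_Quad[OF d'(2)] local_combination_Quad[OF d'(3)]
    by (simp add: insert_commute)
qed

text \<open>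
  By the previous lemma the edge weights are the only possible coefficients of the edges; the
  multiple of \<open>W\<^sub>\<sigma>\<close> is then read off from any one disc type of \<open>\<sigma>\<close>.
\<close>

lemma eq_local_combination:
  obtains w where "s = local_combination w (\<lambda>p. edge_weight s p / 2)"
proof
  \<comment> \<open>Found by solving the equation for one triangle type; the result is symmetric in the labels.\<close>
  let ?w = "\<lambda>\<sigma>. - (\<Sum>a\<in>UNIV. s $ Tri \<sigma> a) / 2 - (\<Sum>q\<in>UNIV. s $ Quad \<sigma> q)"
  let ?Z = "\<lambda>p. edge_weight s p / 2"
  show "s = local_combination ?w ?Z"
  proof (rule vec_eq_iff[THEN iffD2], intro allI)
    fix i
    show "s $ i = local_combination ?w ?Z $ i"
    proof (cases i)
      case (Inl p)
      obtain \<sigma> q where p: "p = (\<sigma>, q)" by (cases p)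
      obtain a b c d where q: "q = facing_quad {a, b}" and d: "distinct [a, b, c, d]"
        by (rule quad_labels)
      have d': "distinct [c, d, a, b]" using d by auto
      have d'': "distinct [a, c, d, b]" using d by auto
      have d3: "distinct [a, d, c, b]" using d by auto
      have "facing_quad {c, a} = facing_quad {a, c}" "facing_quad {c, b} = facing_quad {a, d}"
        using facing_quad_labels(1)[of a d c b] d by (auto simp: insert_commute)
      then show ?thesis unfolding Inl p q local_combination_Quad[OF d] edge_weight_labels[OF d]
          edge_weight_labels[OF d'] sum_labels[OF d] sum_quads[OF d] by (simp add: field_simps)
    next
      case (Inr p)
      obtain \<sigma> a where p: "p = (\<sigma>, a)" by (cases p)
      obtain b where "a \<noteq> b" by (metis zero_neq_one)
      then obtain c d where d: "distinct [a, b, c, d]" by (rule labels_extend)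
      have d': "distinct [a, c, b, d]" "distinct [a, d, b, c]" using d by auto
      show ?thesis unfolding Inr p local_combination_Tri[OF d] edge_weight_labels[OF d]
          edge_weight_labels[OF d'(1)] edge_weight_labels[OF d'(2)] sum_labels[OF d] sum_quads[OF d]
        by (simp add: field_simps)
    qed
  qed
qed

text \<open>
  The left-hand side is one side of a matching equation: the number of arcs cutting off \<open>a\<close> in the
  face \<open>a b c\<close>.  It involves the coefficients of the edges of this face only, so it is preserved by a
  face pairing that preserves these coefficients.
\<close>

lemma local_combination_face:
  assumes "distinct [v, a, b, c]"
  shows "local_combination w Z $ Quad \<sigma> (facing_quad {v, a}) + local_combination w Z $ Tri \<sigma> a =
    Z (\<sigma>, {a, b}) + Z (\<sigma>, {a, c}) - Z (\<sigma>, {b, c})"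
proof -
  have d: "distinct [a, v, b, c]" using assms by auto
  show ?thesis unfolding local_combination_Quad[OF assms] local_combination_Tri[OF d] by (simp add: insert_commute)
qed

text \<open>
  A point of the edge \<open>a b\<close> is an end point of one arc in the face \<open>a b c\<close>, cutting off \<open>a\<close> or \<open>b\<close>.
  Both brackets are sides of matching equations, which is why a face pairing preserves the weights
  of solutions.
\<close>

lemma edge_weight_face:
  assumes "distinct [v, a, b, c]"
  shows "edge_weight s (\<sigma>, {a, b}) =
    (s $ Quad \<sigma> (facing_quad {v, a}) + s $ Tri \<sigma> a) + (s $ Quad \<sigma> (facing_quad {v, b}) + s $ Tri \<sigma> b)"
proof -
  have d: "distinct [a, b, c, v]" using assms by auto
  have "facing_quad {a, c} = facing_quad {v, b}"
    using facing_quad_labels(1)[of v b a c] assms by auto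
  then show ?thesis unfolding edge_weight_labels[OF d] by (simp add: insert_commute)
qed

lemma glue_labels:
  assumes "bij (f :: 4 \<Rightarrow> 4)" "distinct [v, a, b, c]"
  shows "distinct [f v, f a, f b, f c]"
  using assms by (auto simp: bij_def inj_eq)

definition glue_invariant :: "'t pairing set \<Rightarrow> ('t \<times> 4 set \<Rightarrow> real) \<Rightarrow> bool" where
  "glue_invariant \<Phi> Z \<longleftrightarrow> (\<forall>\<phi>\<in>\<Phi>. \<forall>E. card E = 2 \<and> opp_dom \<phi> \<notin> E \<longrightarrow>
     Z (tet_dom \<phi>, E) = Z (tet_cod \<phi>, vmap \<phi> ` E))"

lemma pseudomanifold_bij:
  assumes "triangulated_pseudomanifold \<Phi>" "\<phi> \<in> \<Phi>"
  shows "bij (vmap \<phi>)"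
  using assms by (simp add: triangulated_pseudomanifold_def)

lemma local_combination_in_matching_space:
  assumes "triangulated_pseudomanifold \<Phi>" "glue_invariant \<Phi> Z"
  shows "local_combination w Z \<in> matching_space \<Phi>"
  unfolding matching_space_def
proof (intro CollectI ballI allI impI)
  fix \<phi> a assume \<phi>: "\<phi> \<in> \<Phi>" and a: "a \<noteq> opp_dom \<phi>"
  obtain b c where d: "distinct [opp_dom \<phi>, a, b, c]" using a labels_extend[of "opp_dom \<phi>" a] by metis
  have d': "distinct [vmap \<phi> (opp_dom \<phi>), vmap \<phi> a, vmap \<phi> b, vmap \<phi> c]"
    using pseudomanifold_bij[OF assms(1) \<phi>] d by (rule glue_labels)
  have "Z (tet_dom \<phi>, {x, y}) = Z (tet_cod \<phi>, {vmap \<phi> x, vmap \<phi> y})"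
    if "x \<noteq> opp_dom \<phi>" "y \<noteq> opp_dom \<phi>" "x \<noteq> y" for x y
    using assms(2)[unfolded glue_invariant_def, rule_format, OF \<phi>, of "{x, y}"] that by simp
  then show "local_combination w Z $ Quad (tet_dom \<phi>) (facing_quad {opp_dom \<phi>, a}) +
      local_combination w Z $ Tri (tet_dom \<phi>) a =
      local_combination w Z $ Quad (tet_cod \<phi>) (facing_quad {vmap \<phi> (opp_dom \<phi>), vmap \<phi> a}) +
      local_combination w Z $ Tri (tet_cod \<phi>) (vmap \<phi> a)"
    unfolding local_combination_face[OF d] local_combination_face[OF d'] using d by auto
qed

lemma edge_weight_glue_invariant:
  assumes "triangulated_pseudomanifold \<Phi>" "s \<in> matching_space \<Phi>"
  shows "glue_invariant \<Phi> (edge_weight s)"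
  unfolding glue_invariant_def
proof (intro ballI allI impI)
  fix \<phi> E assume \<phi>: "\<phi> \<in> \<Phi>" and E: "card E = 2 \<and> opp_dom \<phi> \<notin> E"
  obtain a b where ab: "E = {a, b}" "a \<noteq> b" using E by (auto simp: card_2_iff)
  obtain c where d: "distinct [opp_dom \<phi>, a, b, c]"
    using labels_extend3[of "opp_dom \<phi>" a b] E ab by auto
  have d': "distinct [vmap \<phi> (opp_dom \<phi>), vmap \<phi> a, vmap \<phi> b, vmap \<phi> c]"
    using pseudomanifold_bij[OF assms(1) \<phi>] d by (rule glue_labels)
  have eq: "s $ Quad (tet_dom \<phi>) (facing_quad {opp_dom \<phi>, x}) + s $ Tri (tet_dom \<phi>) x =
      s $ Quad (tet_cod \<phi>) (facing_quad {vmap \<phi> (opp_dom \<phi>), vmap \<phi> x}) + s $ Tri (tet_cod \<phi>) (vmap \<phi> x)"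
    if "x \<noteq> opp_dom \<phi>" for x
    using assms(2) \<phi> that by (auto simp: matching_space_def)
  have "a \<noteq> opp_dom \<phi>" "b \<noteq> opp_dom \<phi>" using d by auto
  then show "edge_weight s (tet_dom \<phi>, E) = edge_weight s (tet_cod \<phi>, vmap \<phi> ` E)"
    unfolding ab(1) image_insert image_empty edge_weight_face[OF d] edge_weight_face[OF d']
    by (intro arg_cong2[of _ _ _ _ "(+)"] eq)
qed

section \<open>Classes of identified cells\<close>

lemma equiv_symcl_rtrancl: "equiv UNIV ((R \<union> R\<inverse>)\<^sup>*)"
  by (intro equivI refl_rtrancl trans_rtrancl sym_rtrancl) (auto simp: sym_Un_converse refl_on_def)

lemma symcl_rtrancl_invariant:
  assumes "(p, q) \<in> (R \<union> R\<inverse>)\<^sup>*" "\<And>p q. (p, q) \<in> R \<Longrightarrow> f p = f q"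
  shows "f p = f q"
  using assms(1) by (induction rule: rtrancl_induct) (auto dest: assms(2))

lemma equiv_cell_ident: "equiv UNIV (cell_ident \<Phi>)"
  unfolding cell_ident_def by (rule equiv_symcl_rtrancl)

lemma equiv_flag_ident: "equiv UNIV (flag_ident \<Phi>)"
  unfolding flag_ident_def by (rule equiv_symcl_rtrancl)

lemma quotient_mono: "A \<subseteq> B \<Longrightarrow> A // r \<subseteq> B // r"
  by (auto simp: quotient_def)

lemma sum_quotient:
  fixes f :: "'a \<Rightarrow> 'b::comm_monoid_add"
  assumes "equiv UNIV r" "finite A" "r `` A \<subseteq> A"
  shows "(\<Sum>c\<in>A // r. \<Sum>x\<in>c. f x) = (\<Sum>x\<in>A. f x)"
proof -
  have U: "\<Union> (A // r) = A"
    using assms by (auto simp: quotient_def Image_def equiv_def refl_on_def)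
  have "sum f (\<Union> (A // r)) = (sum \<circ> sum) f (A // r)"
  proof (rule sum.Union_disjoint)
    show "\<forall>c\<in>A // r. finite c" using U assms(2) by (metis Union_upper finite_subset)
    show "\<forall>c\<in>A // r. \<forall>d\<in>A // r. c \<noteq> d \<longrightarrow> c \<inter> d = {}"
      using assms(1) by (meson quotient_disj quotient_mono subsetD top_greatest)
  qed
  then show ?thesis by (simp add: U)
qed

text \<open>
  Every class of size \<open>k\<close> is counted by its \<open>k\<close> elements with weight \<open>1 / k\<close> each.  This is how
  \<open>\<chi>\<^sup>*\<close> distributes the cells of a surface over its discs.
\<close>

lemma card_quotient:
  assumes "equiv UNIV r" "finite A" "r `` A \<subseteq> A"
  shows "real (card (A // r)) = (\<Sum>x\<in>A. 1 / real (card (r `` {x})))"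
proof -
  have "(\<Sum>x\<in>A. 1 / real (card (r `` {x}))) = (\<Sum>c\<in>A // r. \<Sum>x\<in>c. 1 / real (card (r `` {x})))"
    using assms by (rule sum_quotient[symmetric])
  also have "\<dots> = (\<Sum>c\<in>A // r. 1)"
  proof (rule sum.cong[OF refl])
    fix c assume "c \<in> A // r"
    then obtain x where x: "x \<in> A" "c = r `` {x}" by (rule quotientE)
    have "r `` {y} = c" if "y \<in> c" for y
      using that x assms(1) by (metis Image_singleton_iff equiv_class_eq)
    then have "(\<Sum>x\<in>c. 1 / real (card (r `` {x}))) = (\<Sum>x\<in>c. 1 / real (card c))"
      by (intro sum.cong) auto
    moreover have "c \<subseteq> A" using x assms(3) by auto
    then have "finite c" using assms(2) by (rule finite_subset)
    moreover have "x \<in> c" using x(2) assms(1) by (simp add: equiv_def refl_on_def)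
    ultimately show "(\<Sum>x\<in>c. 1 / real (card (r `` {x}))) = 1" by (auto simp: card_eq_0_iff)
  qed
  finally show ?thesis by simp
qed

lemma pseudomanifold_inj:
  assumes "triangulated_pseudomanifold \<Phi>" "\<phi> \<in> \<Phi>"
  shows "inj_on (vmap \<phi>) A"
  using pseudomanifold_bij[OF assms] bij_is_inj inj_on_subset by blast

lemma cell_ident_card:
  assumes "triangulated_pseudomanifold \<Phi>" "(p, q) \<in> cell_ident \<Phi>"
  shows "card (snd p) = card (snd q)"
proof -
  have "card (snd p) = card (snd q)" if "(p, q) \<in> cell_glue \<Phi>" for p q
    using that pseudomanifold_inj[OF assms(1)] by (auto simp: cell_glue_def card_image)
  with assms(2) show ?thesis unfolding cell_ident_def by (rule symcl_rtrancl_invariant)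
qed

lemma edge_classI:
  assumes "e \<in> edges \<Phi>" "(\<sigma>, E) \<in> e"
  shows "edge_class \<Phi> \<sigma> E = e"
proof -
  obtain p where e: "e = cell_ident \<Phi> `` {p}" using assms(1) unfolding edges_def by (rule quotientE)
  then have "(p, (\<sigma>, E)) \<in> cell_ident \<Phi>" using assms(2) by simp
  then show ?thesis unfolding edge_class_def e by (rule equiv_class_eq[OF equiv_cell_ident, symmetric])
qed

lemma edge_class_in_edges: "card E = 2 \<Longrightarrow> edge_class \<Phi> \<sigma> E \<in> edges \<Phi>"
  unfolding edges_def edge_class_def by (auto intro: quotientI)

lemma edge_class_self: "(\<sigma>, E) \<in> edge_class \<Phi> \<sigma> E"
  unfolding edge_class_def cell_ident_def by simp

lemma card_edge_member:
  assumes "triangulated_pseudomanifold \<Phi>" "e \<in> edges \<Phi>" "(\<sigma>, E) \<in> e"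
  shows "card E = 2"
  using assms(2,3) cell_ident_card[OF assms(1)] unfolding edges_def
  by (force elim!: quotientE)

lemma edge_nonempty:
  assumes "e \<in> edges \<Phi>"
  obtains \<sigma> E where "(\<sigma>, E) \<in> e"
proof -
  have "e \<noteq> {}"
    using assms in_quotient_imp_non_empty[OF equiv_cell_ident] quotient_mono[OF subset_UNIV]
    unfolding edges_def by blast
  then show thesis using that by auto
qed

lemma mem_edge_iff:
  assumes "e \<in> edges \<Phi>"
  shows "(\<sigma>, E) \<in> e \<longleftrightarrow> edge_class \<Phi> \<sigma> E = e"
  using edge_classI[OF assms] edge_class_self by metis

lemma finite_edges: "finite (edges (\<Phi> :: ('t::finite) pairing set))"
  by simp

lemma sum_edges:
  fixes f :: "('t::finite) \<times> 4 set \<Rightarrow> real"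
  assumes "triangulated_pseudomanifold \<Phi>"
  shows "(\<Sum>e\<in>edges \<Phi>. \<Sum>p\<in>e. f p) = (\<Sum>\<sigma>\<in>UNIV. \<Sum>E | card E = 2. f (\<sigma>, E))"
proof -
  have "(\<Sum>e\<in>edges \<Phi>. \<Sum>p\<in>e. f p) = (\<Sum>p\<in>{(\<sigma>, E). card E = 2}. f p)"
    unfolding edges_def using cell_ident_card[OF assms]
    by (intro sum_quotient equiv_cell_ident finite) force
  also have "{(\<sigma> :: 't, E :: 4 set). card E = 2} = UNIV \<times> {E. card E = 2}" by auto
  finally show ?thesis by (simp add: sum.cartesian_product)
qed

section \<open>The basis of the matching space\<close>

lemma W_tet_Tri: "W_tet \<tau> $ Tri \<sigma> a = of_bool (\<sigma> = \<tau>)"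
  and W_tet_Quad: "W_tet \<tau> $ Quad \<sigma> q = - of_bool (\<sigma> = \<tau>)"
  by (auto simp: W_tet_def axis_def of_bool_def if_distrib cong: if_cong)

lemma W_edge_components:
  fixes e :: "('t::finite \<times> 4 set) set"
  assumes "\<And>\<sigma> E. (\<sigma>, E) \<in> e \<Longrightarrow> card E = 2"
  shows "W_edge e $ Tri \<sigma> a = (\<Sum>E | card E = 2 \<and> a \<in> E. of_bool ((\<sigma>, E) \<in> e))"
    and "W_edge e $ Quad \<sigma> q = - (\<Sum>E\<in>quad_edges q. of_bool ((\<sigma>, E) \<in> e))"
proof -
  have *: "(\<Sum>p\<in>e. of_bool (fst p = \<sigma> \<and> P (snd p)) :: real) = (\<Sum>E | card E = 2 \<and> P E. of_bool ((\<sigma>, E) \<in> e))"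
    for P :: "4 set \<Rightarrow> bool"
  proof -
    have "(\<Sum>p\<in>e. of_bool (fst p = \<sigma> \<and> P (snd p)) :: real) = card {p \<in> e. fst p = \<sigma> \<and> P (snd p)}"
      by (simp add: sum.If_cases of_bool_def Int_def)
    also have "{p \<in> e. fst p = \<sigma> \<and> P (snd p)} = Pair \<sigma> ` {E. (card E = 2 \<and> P E) \<and> (\<sigma>, E) \<in> e}"
      using assms by force
    also have "real (card \<dots>) = card {E. (card E = 2 \<and> P E) \<and> (\<sigma>, E) \<in> e}"
      by (simp add: card_image inj_on_def)
    also have "\<dots> = (\<Sum>E | card E = 2 \<and> P E. of_bool ((\<sigma>, E) \<in> e))"
      by (simp add: sum.If_cases of_bool_def Int_def)
    finally show ?thesis .
  qed
  have tri: "(\<Sum>b\<in>E. axis (Tri \<tau> b) 1 :: real ^ 't ndisc) $ Tri \<sigma> a = of_bool (\<tau> = \<sigma> \<and> a \<in> E)"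
    for \<tau> and E :: "4 set"
    by (cases "\<tau> = \<sigma>") (auto simp: axis_def sum.delta')
  have "W_edge e $ Tri \<sigma> a = (\<Sum>p\<in>e. of_bool (fst p = \<sigma> \<and> a \<in> snd p))"
    unfolding W_edge_def sum_component
    by (intro sum.cong refl) (clarsimp simp: tri simp del: sum_component, simp add: axis_def)
  then show "W_edge e $ Tri \<sigma> a = (\<Sum>E | card E = 2 \<and> a \<in> E. of_bool ((\<sigma>, E) \<in> e))"
    unfolding *[of "\<lambda>E. a \<in> E"] .
  have "W_edge e $ Quad \<sigma> q = (\<Sum>p\<in>e. - of_bool (fst p = \<sigma> \<and> facing_quad (snd p) = q))"
    unfolding W_edge_def sum_component
    by (intro sum.cong refl) (auto simp: axis_def of_bool_def split: prod.split)
  also have "\<dots> = - (\<Sum>E | card E = 2 \<and> facing_quad E = q. of_bool ((\<sigma>, E) \<in> e))"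
    unfolding sum_negf *[of "\<lambda>E. facing_quad E = q"] by (rule refl)
  also have "{E. card E = 2 \<and> facing_quad E = q} = quad_edges q"
    using quad_edges_iff by auto
  finally show "W_edge e $ Quad \<sigma> q = - (\<Sum>E\<in>quad_edges q. of_bool ((\<sigma>, E) \<in> e))" .
qed

definition W_combination ::
  "'t pairing set \<Rightarrow> ('t \<Rightarrow> real) \<Rightarrow> (('t \<times> 4 set) set \<Rightarrow> real) \<Rightarrow> real ^ ('t::finite) ndisc" where
  "W_combination \<Phi> w z = (\<Sum>\<sigma>\<in>UNIV. w \<sigma> *\<^sub>R W_tet \<sigma>) + (\<Sum>e\<in>edges \<Phi>. z e *\<^sub>R W_edge e)"

lemma W_combination_eq_local_combination:
  assumes "triangulated_pseudomanifold \<Phi>"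
  shows "W_combination \<Phi> w z = local_combination w (\<lambda>(\<sigma>, E). z (edge_class \<Phi> \<sigma> E))"
proof -
  have sub: "(\<Sum>e\<in>edges \<Phi>. z e * (\<Sum>E\<in>A. of_bool ((\<sigma>, E) \<in> e))) = (\<Sum>E\<in>A. z (edge_class \<Phi> \<sigma> E))"
    if "\<And>E. E \<in> A \<Longrightarrow> card E = 2" for A \<sigma>
  proof -
    have "(\<Sum>e\<in>edges \<Phi>. z e * (\<Sum>E\<in>A. of_bool ((\<sigma>, E) \<in> e))) =
      (\<Sum>E\<in>A. \<Sum>e\<in>edges \<Phi>. z e * of_bool ((\<sigma>, E) \<in> e))"
      unfolding sum_distrib_left by (rule sum.swap)
    also have "\<dots> = (\<Sum>E\<in>A. z (edge_class \<Phi> \<sigma> E))"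
    proof (rule sum.cong[OF refl])
      fix E assume "E \<in> A"
      have "(\<Sum>e\<in>edges \<Phi>. z e * of_bool ((\<sigma>, E) \<in> e)) =
        (\<Sum>e\<in>edges \<Phi>. if e = edge_class \<Phi> \<sigma> E then z e else 0)"
        by (rule sum.cong) (simp_all add: mem_edge_iff[where \<Phi> = \<Phi>] eq_commute)
      also have "\<dots> = z (edge_class \<Phi> \<sigma> E)"
        using edge_class_in_edges[OF that[OF \<open>E \<in> A\<close>], of \<Phi> \<sigma>] by (simp add: sum.delta)
      finally show "(\<Sum>e\<in>edges \<Phi>. z e * of_bool ((\<sigma>, E) \<in> e)) = z (edge_class \<Phi> \<sigma> E)" .
    qed
    finally show ?thesis .
  qed
  note W = W_edge_components[OF card_edge_member[OF assms]]
  show ?thesis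
  proof (rule vec_eq_iff[THEN iffD2], intro allI)
    fix i
    show "W_combination \<Phi> w z $ i = local_combination w (\<lambda>(\<sigma>, E). z (edge_class \<Phi> \<sigma> E)) $ i"
    proof (cases i)
      case (Inl p)
      obtain \<sigma> q where p: "p = (\<sigma>, q)" by (cases p)
      have "W_combination \<Phi> w z $ i = - w \<sigma> - (\<Sum>e\<in>edges \<Phi>. z e * (\<Sum>E\<in>quad_edges q. of_bool ((\<sigma>, E) \<in> e)))"
        unfolding W_combination_def Inl p
        by (simp add: W_tet_Quad W of_bool_def sum_negf if_distrib cong: if_cong)
      also have "(\<Sum>e\<in>edges \<Phi>. z e * (\<Sum>E\<in>quad_edges q. of_bool ((\<sigma>, E) \<in> e))) =
        (\<Sum>E\<in>quad_edges q. z (edge_class \<Phi> \<sigma> E))"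
        by (rule sub) (simp add: quad_edges_iff)
      finally show ?thesis by (simp add: local_combination_def Inl p)
    next
      case (Inr p)
      obtain \<sigma> a where p: "p = (\<sigma>, a)" by (cases p)
      have "W_combination \<Phi> w z $ i = w \<sigma> +
        (\<Sum>e\<in>edges \<Phi>. z e * (\<Sum>E | card E = 2 \<and> a \<in> E. of_bool ((\<sigma>, E) \<in> e)))"
        unfolding W_combination_def Inr p
        by (simp add: W_tet_Tri W of_bool_def if_distrib cong: if_cong)
      also have "(\<Sum>e\<in>edges \<Phi>. z e * (\<Sum>E | card E = 2 \<and> a \<in> E. of_bool ((\<sigma>, E) \<in> e))) =
        (\<Sum>E | card E = 2 \<and> a \<in> E. z (edge_class \<Phi> \<sigma> E))"
        by (rule sub) simp
      finally show ?thesis by (simp add: local_combination_def Inr p)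
    qed
  qed
qed

lemma edge_class_glue:
  assumes "\<phi> \<in> \<Phi>" "opp_dom \<phi> \<notin> E"
  shows "edge_class \<Phi> (tet_dom \<phi>) E = edge_class \<Phi> (tet_cod \<phi>) (vmap \<phi> ` E)"
proof -
  have "((tet_dom \<phi>, E), (tet_cod \<phi>, vmap \<phi> ` E)) \<in> cell_ident \<Phi>"
    using assms by (auto simp: cell_ident_def cell_glue_def intro!: r_into_rtrancl)
  then show ?thesis unfolding edge_class_def by (rule equiv_class_eq[OF equiv_cell_ident])
qed

lemma W_combination_in_matching_space:
  assumes "triangulated_pseudomanifold \<Phi>"
  shows "W_combination \<Phi> w z \<in> matching_space \<Phi>"
  unfolding W_combination_eq_local_combination[OF assms]
  by (intro local_combination_in_matching_space[OF assms])
    (auto simp: glue_invariant_def dest: edge_class_glue)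

lemma edge_weight_W_combination:
  assumes "triangulated_pseudomanifold \<Phi>" "card E = 2"
  shows "edge_weight (W_combination \<Phi> w z) (\<sigma>, E) = 2 * z (edge_class \<Phi> \<sigma> E)"
  by (simp add: W_combination_eq_local_combination[OF assms(1)] edge_weight_local_combination[OF assms(2)])

lemma glue_invariant_cell_ident:
  assumes "triangulated_pseudomanifold \<Phi>" "glue_invariant \<Phi> Z" "card E = 2"
    "((\<sigma>, E), (\<tau>, F)) \<in> cell_ident \<Phi>"
  shows "Z (\<sigma>, E) = Z (\<tau>, F)"
proof -
  \<comment> \<open>The hypothesis on \<open>Z\<close> concerns edges only; extended by a constant, \<open>Z\<close> is invariant under gluings of all cells.\<close>
  let ?f = "\<lambda>p. if card (snd p) = 2 then Z p else 0"
  have "?f p = ?f q" if "(p, q) \<in> cell_glue \<Phi>" for p q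
  proof -
    have "(p, q) \<in> cell_ident \<Phi>" using that by (auto simp: cell_ident_def)
    then have "card (snd p) = card (snd q)" by (rule cell_ident_card[OF assms(1)])
    then show ?thesis using that assms(2) by (auto simp: cell_glue_def glue_invariant_def)
  qed
  then have "?f (\<sigma>, E) = ?f (\<tau>, F)"
    using assms(4) unfolding cell_ident_def by (rule symcl_rtrancl_invariant[rotated])
  then show ?thesis using assms(3) cell_ident_card[OF assms(1,4)] by simp
qed

text \<open>
  The \<open>W\<^sub>\<sigma>\<close> and \<open>W\<^sub>e\<close> span the matching space: half the edge weights of a solution are coefficients in
  each tetrahedron separately, and they agree on all copies of an edge.
\<close>

theorem W_combination_exists:
  assumes "triangulated_pseudomanifold \<Phi>" "s \<in> matching_space \<Phi>"
  obtains w z where "s = W_combination \<Phi> w z"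
proof -
  obtain w where w: "s = local_combination w (\<lambda>p. edge_weight s p / 2)" by (rule eq_local_combination)
  define z where "z e = edge_weight s (SOME p. p \<in> e) / 2" for e
  have z: "z (edge_class \<Phi> \<sigma> E) = edge_weight s (\<sigma>, E) / 2" if "card E = 2" for \<sigma> E
  proof -
    obtain \<tau> F where p: "(SOME p. p \<in> edge_class \<Phi> \<sigma> E) = (\<tau>, F)" by fastforce
    have "(\<tau>, F) \<in> edge_class \<Phi> \<sigma> E" unfolding p[symmetric] using edge_class_self by (rule someI)
    then have "((\<sigma>, E), (\<tau>, F)) \<in> cell_ident \<Phi>" by (simp add: edge_class_def)
    from glue_invariant_cell_ident[OF assms(1) edge_weight_glue_invariant[OF assms] that this]
    show ?thesis by (simp add: z_def p)
  qed
  have cong: "local_combination w Y = local_combination w Z" if "\<And>\<sigma> E. card E = 2 \<Longrightarrow> Y (\<sigma>, E) = Z (\<sigma>, E)"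
    for Y Z :: "'a \<times> 4 set \<Rightarrow> real"
  proof -
    have "(\<Sum>E\<in>quad_edges q. Y (\<sigma>, E)) = (\<Sum>E\<in>quad_edges q. Z (\<sigma>, E))" for q \<sigma>
      using that by (intro sum.cong) (auto simp: quad_edges_iff)
    moreover have "(\<Sum>E | card E = 2 \<and> a \<in> E. Y (\<sigma>, E)) = (\<Sum>E | card E = 2 \<and> a \<in> E. Z (\<sigma>, E))" for a \<sigma>
      using that by (intro sum.cong) auto
    ultimately show ?thesis unfolding local_combination_def by simp
  qed
  have "s = W_combination \<Phi> w z"
    unfolding W_combination_eq_local_combination[OF assms(1)]
    by (subst w) (rule cong, simp add: z)
  then show thesis by (rule that)
qed

text \<open>
  The coefficient \<open>z e\<close> is half the edge weight along \<open>e\<close>, so it depends on the vector alone and the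
  definite description in \<open>chi_curv\<close> is unambiguous.
\<close>

lemma chi_curv_W_combination:
  assumes "triangulated_pseudomanifold \<Phi>"
  shows "chi_curv \<Phi> \<kappa> (W_combination \<Phi> w z) = (\<Sum>e\<in>edges \<Phi>. z e * \<kappa> e) / pi"
proof -
  have "z' e = z e" if e: "e \<in> edges \<Phi>" and eq: "W_combination \<Phi> w z = W_combination \<Phi> w' z'" for w' z' e
  proof -
    obtain \<sigma> E where E: "(\<sigma>, E) \<in> e" using edge_nonempty[OF e] by blast
    note weight = edge_weight_W_combination[OF assms card_edge_member[OF assms e E], of _ _ \<sigma>]
    show ?thesis using weight[of w z] weight[of w' z'] eq by (simp add: edge_classI[OF e E])
  qed
  then have eq: "(\<Sum>e\<in>edges \<Phi>. 2 * z' e * \<kappa> e) = (\<Sum>e\<in>edges \<Phi>. 2 * z e * \<kappa> e)"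
    if "W_combination \<Phi> w z = W_combination \<Phi> w' z'" for w' z'
    using that by (intro sum.cong) auto
  have "chi_curv \<Phi> \<kappa> (W_combination \<Phi> w z) = 1 / (2 * pi) * (\<Sum>e\<in>edges \<Phi>. 2 * z e * \<kappa> e)"
    unfolding chi_curv_def W_combination_def[symmetric]
  proof (rule the_equality)
    show "\<exists>w' z'. W_combination \<Phi> w z = W_combination \<Phi> w' z' \<and>
      1 / (2 * pi) * (\<Sum>e\<in>edges \<Phi>. 2 * z e * \<kappa> e) = 1 / (2 * pi) * (\<Sum>e\<in>edges \<Phi>. 2 * z' e * \<kappa> e)"
      by blast
  next
    fix r assume "\<exists>w' z'. W_combination \<Phi> w z = W_combination \<Phi> w' z' \<and>
      r = 1 / (2 * pi) * (\<Sum>e\<in>edges \<Phi>. 2 * z' e * \<kappa> e)"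
    then obtain w' z' where "W_combination \<Phi> w z = W_combination \<Phi> w' z'"
      and r: "r = 1 / (2 * pi) * (\<Sum>e\<in>edges \<Phi>. 2 * z' e * \<kappa> e)" by blast
    then show "r = 1 / (2 * pi) * (\<Sum>e\<in>edges \<Phi>. 2 * z e * \<kappa> e)" by (simp only: eq)
  qed
  also have "(\<Sum>e\<in>edges \<Phi>. 2 * z e * \<kappa> e) = 2 * (\<Sum>e\<in>edges \<Phi>. z e * \<kappa> e)"
    by (simp add: sum_distrib_left mult.assoc)
  finally show ?thesis by simp
qed

section \<open>The tetrahedra around an edge\<close>

text \<open>
  Read \<open>N\<close> as the nodes of a graph and \<open>M\<close> as its edges, \<open>m\<close> joining \<open>s m\<close> to \<open>t m\<close>.  Starting from \<open>x\<close>,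
  a tree grows by one node and one edge at a time until it contains all nodes.
\<close>

lemma connected_graph_card_le:
  fixes s t :: "'m \<Rightarrow> 'n"
  assumes "finite M" "finite N" "x \<in> N" "s ` M \<subseteq> N" "t ` M \<subseteq> N"
    and connected: "\<And>y. y \<in> N \<Longrightarrow> (x, y) \<in> ((\<lambda>m. (s m, t m)) ` M \<union> ((\<lambda>m. (s m, t m)) ` M)\<inverse>)\<^sup>*"
  shows "card N \<le> card M + 1"
proof -
  let ?R = "(\<lambda>m. (s m, t m)) ` M \<union> ((\<lambda>m. (s m, t m)) ` M)\<inverse>"
  have grow: "\<exists>A F. x \<in> A \<and> A \<subseteq> N \<and> card A = Suc k \<and> F \<subseteq> M \<and> card F = k \<and> s ` F \<union> t ` F \<subseteq> A"
    if "Suc k \<le> card N" for k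
    using that
  proof (induction k)
    case 0
    show ?case by (rule exI[of _ "{x}"], rule exI[of _ "{}"]) (use assms(3) in simp)
  next
    case (Suc k)
    then obtain A F where IH: "x \<in> A" "A \<subseteq> N" "card A = Suc k" "F \<subseteq> M" "card F = k" "s ` F \<union> t ` F \<subseteq> A"
      by auto
    then obtain y where y: "y \<in> N" "y \<notin> A" using Suc.prems by (metis Suc_n_not_le_n subsetI subset_antisym)
    have "\<exists>p q. (p, q) \<in> ?R \<and> p \<in> A \<and> q \<notin> A"
    proof (rule ccontr)
      assume no: "\<not> ?thesis"
      have "z \<in> A" if "(x, z) \<in> ?R\<^sup>*" for z
        using that by (induction rule: rtrancl_induct) (use no IH(1) in blast)+
      then show False using connected[OF y(1)] y(2) by blast
    qed
    then obtain p q where pq: "(p, q) \<in> ?R" "p \<in> A" "q \<notin> A" by blast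
    then obtain m where m: "m \<in> M" "s m = p \<and> t m = q \<or> s m = q \<and> t m = p" by blast
    have "m \<notin> F" using IH(6) m(2) pq(3) by auto
    have fin: "finite A" "finite F" using IH(2,4) assms(1,2) finite_subset by auto
    have "q \<in> N" using m assms(4,5) by auto
    show ?case
    proof (intro exI conjI)
      show "card (insert q A) = Suc (Suc k)" using IH(3) fin pq(3) by simp
      show "card (insert m F) = Suc k" using IH(5) fin \<open>m \<notin> F\<close> by simp
      show "s ` insert m F \<union> t ` insert m F \<subseteq> insert q A" using IH(6) m(2) pq(2) by auto
    qed (use IH \<open>q \<in> N\<close> m(1) in auto)
  qed
  have "0 < card N" using assms(2,3) by (auto simp: card_gt_0_iff)
  then have "Suc (card N - 1) \<le> card N" by simp
  from grow[OF this] obtain F where "F \<subseteq> M" "card F = card N - 1" by blast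
  then have "card N - 1 \<le> card M" using card_mono[OF assms(1)] by metis
  then show ?thesis by simp
qed

lemma pseudomanifold_faces:
  assumes "triangulated_pseudomanifold \<Phi>" "\<phi> \<in> \<Phi>" "\<psi> \<in> \<Phi>"
  shows "dom_face \<phi> \<noteq> cod_face \<psi>"
    and "dom_face \<phi> = dom_face \<psi> \<Longrightarrow> \<phi> = \<psi>"
    and "cod_face \<phi> = cod_face \<psi> \<Longrightarrow> \<phi> = \<psi>"
proof -
  have *: "dom_face \<phi> \<noteq> cod_face \<phi>"
    "\<phi> \<noteq> \<psi> \<Longrightarrow> {dom_face \<phi>, cod_face \<phi>} \<inter> {dom_face \<psi>, cod_face \<psi>} = {}"
    using assms(1)[unfolded triangulated_pseudomanifold_def, THEN conjunct1]
      assms(1)[unfolded triangulated_pseudomanifold_def, THEN conjunct2, THEN conjunct1] assms(2,3)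
    by blast+
  show "dom_face \<phi> \<noteq> cod_face \<psi>" using * by (cases "\<phi> = \<psi>") auto
  show "dom_face \<phi> = dom_face \<psi> \<Longrightarrow> \<phi> = \<psi>" using *(2) by (cases "\<phi> = \<psi>") auto
  show "cod_face \<phi> = cod_face \<psi> \<Longrightarrow> \<phi> = \<psi>" using *(2) by (cases "\<phi> = \<psi>") auto
qed

lemma pseudomanifold_finite:
  fixes \<Phi> :: "('t::finite) pairing set"
  assumes "triangulated_pseudomanifold \<Phi>"
  shows "finite \<Phi>"
  by (rule finite_imageD[of dom_face]) (auto intro: inj_onI pseudomanifold_faces(2)[OF assms])

lemma cell_glue_in_edge:
  assumes "e \<in> edges \<Phi>" "(p, q) \<in> cell_glue \<Phi>"
  shows "p \<in> e \<longleftrightarrow> q \<in> e"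
proof -
  obtain \<sigma> E \<tau> F where pq: "p = (\<sigma>, E)" "q = (\<tau>, F)" by fastforce
  with assms(2) have "edge_class \<Phi> \<sigma> E = edge_class \<Phi> \<tau> F"
    by (auto simp: cell_glue_def edge_class_glue)
  then show ?thesis unfolding pq mem_edge_iff[OF assms(1)] by simp
qed

text \<open>
  A face through \<open>E\<close> is named by its opposite vertex, hence \<open>v \<notin> E\<close>.
\<close>

definition unpaired_sides :: "'t pairing set \<Rightarrow> 't \<times> 4 set \<Rightarrow> 4 set" where
  "unpaired_sides \<Phi> = (\<lambda>(\<sigma>, E). {v. v \<notin> E \<and> (\<sigma>, v) \<in> unpaired_faces \<Phi>})"

text \<open>
  Consider the graph whose nodes are the copies of \<open>e\<close> in the tetrahedra and whose edges are the face
  pairings that identify them.  Each node has two sides, namely the two faces through that copy, and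
  each pairing uses up two sides, so the number of unpaired sides is twice the difference between
  the numbers of nodes and of edges.  By connectedness this difference is at most one.
\<close>

lemma sum_card_unpaired_sides:
  fixes \<Phi> :: "('t::finite) pairing set"
  assumes \<Phi>: "triangulated_pseudomanifold \<Phi>" and e: "e \<in> edges \<Phi>"
  shows "(\<Sum>p\<in>e. card (unpaired_sides \<Phi> p)) = (if boundary_edge \<Phi> e then 2 else 0)"
proof -
  define M where "M = {(\<phi>, E). \<phi> \<in> \<Phi> \<and> opp_dom \<phi> \<notin> E \<and> (tet_dom \<phi>, E) \<in> e}"
  define s :: "'t pairing \<times> 4 set \<Rightarrow> _" where "s = (\<lambda>(\<phi>, E). (tet_dom \<phi>, E))"
  define t :: "'t pairing \<times> 4 set \<Rightarrow> _" where "t = (\<lambda>(\<phi>, E). (tet_cod \<phi>, vmap \<phi> ` E))"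
  \<comment> \<open>The sides on which the graph edges start and end; together with the unpaired sides \<open>U\<close> these are all sides.\<close>
  define D where "D = (\<lambda>(\<phi>, E). ((tet_dom \<phi>, E), opp_dom \<phi>)) ` M"
  define C where "C = (\<lambda>(\<phi>, E). ((tet_cod \<phi>, vmap \<phi> ` E), vmap \<phi> (opp_dom \<phi>))) ` M"
  define U where "U = Sigma e (unpaired_sides \<Phi>)"
  have glue_M: "(s m, t m) \<in> cell_glue \<Phi>" if "m \<in> M" for m
    using that by (auto simp: M_def s_def t_def cell_glue_def)
  have st: "s m \<in> e" "t m \<in> e" if "m \<in> M" for m
    using that cell_glue_in_edge[OF e glue_M[OF that]] by (auto simp: M_def s_def)
  have "M \<subseteq> \<Phi> \<times> UNIV" by (auto simp: M_def)
  then have finM: "finite M" using pseudomanifold_finite[OF \<Phi>] by (meson finite finite_SigmaI finite_subset)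
  have le: "card e \<le> card M + 1"
  proof -
    obtain p where p: "e = cell_ident \<Phi> `` {p}" using e unfolding edges_def by (rule quotientE)
    let ?R = "(\<lambda>m. (s m, t m)) ` M"
    have glueR: "(y, z) \<in> ?R" if "(y, z) \<in> cell_glue \<Phi>" "y \<in> e" for y z
      using that by (auto simp: cell_glue_def M_def s_def t_def image_iff)
    have "y \<in> e \<and> (p, y) \<in> (?R \<union> ?R\<inverse>)\<^sup>*" if "(p, y) \<in> (cell_glue \<Phi> \<union> (cell_glue \<Phi>)\<inverse>)\<^sup>*" for y
      using that
    proof (induction rule: rtrancl_induct)
      case base
      then show ?case by (simp add: p cell_ident_def)
    next
      case (step y z)
      then have "z \<in> e" using cell_glue_in_edge[OF e] by blast
      moreover have "(y, z) \<in> ?R \<union> ?R\<inverse>" using step glueR \<open>z \<in> e\<close> by blast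
      ultimately show ?case using step.IH by (meson rtrancl.rtrancl_into_rtrancl)
    qed
    then have conn: "(p, y) \<in> (?R \<union> ?R\<inverse>)\<^sup>*" if "y \<in> e" for y using that by (simp add: p cell_ident_def)
    have "p \<in> e" by (simp add: p cell_ident_def)
    show ?thesis
      by (rule connected_graph_card_le[OF finM finite \<open>p \<in> e\<close> _ _ conn]) (use st in auto)
  qed
  have "inj_on (\<lambda>(\<phi>, E). ((tet_dom \<phi>, E), opp_dom \<phi>)) M"
    using pseudomanifold_faces(2)[OF \<Phi>] by (auto simp: inj_on_def M_def dom_face_def)
  then have cD: "card D = card M" unfolding D_def by (rule card_image)
  have "inj_on (\<lambda>(\<phi>, E). ((tet_cod \<phi>, vmap \<phi> ` E), vmap \<phi> (opp_dom \<phi>))) M"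
  proof (rule inj_onI, clarify)
    fix \<phi> E \<psi> F
    assume "(\<phi>, E) \<in> M" "(\<psi>, F) \<in> M"
      and eq: "tet_cod \<phi> = tet_cod \<psi>" "vmap \<phi> ` E = vmap \<psi> ` F" "vmap \<phi> (opp_dom \<phi>) = vmap \<psi> (opp_dom \<psi>)"
    then have "\<phi> \<in> \<Phi>" "\<psi> \<in> \<Phi>" by (auto simp: M_def)
    then have "\<phi> = \<psi>" using pseudomanifold_faces(3)[OF \<Phi>] eq by (simp add: cod_face_def)
    then show "\<phi> = \<psi> \<and> E = F"
      using eq(2) pseudomanifold_inj[OF \<Phi> \<open>\<psi> \<in> \<Phi>\<close>, of UNIV] by (auto simp: inj_image_eq_iff)
  qed
  then have cC: "card C = card M" unfolding C_def by (rule card_image)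
  have DC: "D \<inter> C = {}"
    using pseudomanifold_faces(1)[OF \<Phi>] by (auto simp: D_def C_def M_def dom_face_def cod_face_def)
  have unp: "(\<sigma>, v) \<in> unpaired_faces \<Phi> \<longleftrightarrow> (\<forall>\<phi>\<in>\<Phi>. (\<sigma>, v) \<noteq> dom_face \<phi> \<and> (\<sigma>, v) \<noteq> cod_face \<phi>)" for \<sigma> v
    by (auto simp: unpaired_faces_def)
  have U_DC: "U \<inter> (D \<union> C) = {}"
    by (auto simp: U_def unpaired_sides_def D_def C_def M_def unp dom_face_def cod_face_def)
  have P: "Sigma e (\<lambda>p. - snd p) = U \<union> (D \<union> C)"
  proof (intro equalityI subsetI)
    fix x assume x: "x \<in> Sigma e (\<lambda>p. - snd p)"
    then obtain \<sigma> E v where xe: "x = ((\<sigma>, E), v)" "(\<sigma>, E) \<in> e" "v \<notin> E" by auto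
    show "x \<in> U \<union> (D \<union> C)"
    proof (cases "(\<sigma>, v) \<in> unpaired_faces \<Phi>")
      case True
      then show ?thesis using xe by (simp add: U_def unpaired_sides_def)
    next
      case False
      then obtain \<phi> where \<phi>: "\<phi> \<in> \<Phi>" and "(\<sigma>, v) = dom_face \<phi> \<or> (\<sigma>, v) = cod_face \<phi>"
        using unp by blast
      then consider "\<sigma> = tet_dom \<phi>" "v = opp_dom \<phi>" | "\<sigma> = tet_cod \<phi>" "v = vmap \<phi> (opp_dom \<phi>)"
        by (auto simp: dom_face_def cod_face_def)
      then show ?thesis
      proof cases
        case 1
        then have "(\<phi>, E) \<in> M" using \<phi> xe by (simp add: M_def)
        then have "x \<in> D" unfolding D_def xe(1) 1 by (rule rev_image_eqI) simp
        then show ?thesis by simp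
      next
        case 2
        define F where "F = vmap \<phi> -` E"
        have E: "vmap \<phi> ` F = E"
          unfolding F_def using pseudomanifold_bij[OF \<Phi> \<phi>] by (simp add: bij_is_surj surj_image_vimage_eq)
        have "opp_dom \<phi> \<notin> F" using xe(3) 2 by (simp add: F_def)
        then have "((tet_dom \<phi>, F), (\<sigma>, E)) \<in> cell_glue \<Phi>" using \<phi> E 2 by (auto simp: cell_glue_def)
        then have "(tet_dom \<phi>, F) \<in> e" using cell_glue_in_edge[OF e] xe(2) by blast
        then have "(\<phi>, F) \<in> M" using \<phi> \<open>opp_dom \<phi> \<notin> F\<close> by (simp add: M_def)
        then have "x \<in> C" unfolding C_def xe(1) 2 by (rule rev_image_eqI) (simp add: E)
        then show ?thesis by simp
      qed
    qed
  next
    fix x assume "x \<in> U \<union> (D \<union> C)"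
    then consider "x \<in> U" | m where "m \<in> M" "x = (s m, opp_dom (fst m))"
      | m where "m \<in> M" "x = (t m, vmap (fst m) (opp_dom (fst m)))"
      by (force simp: D_def C_def s_def t_def)
    then show "x \<in> Sigma e (\<lambda>p. - snd p)"
    proof cases
      case 1
      then show ?thesis by (auto simp: U_def unpaired_sides_def)
    next
      case 2
      then show ?thesis using st(1)[of m] by (auto simp: s_def M_def)
    next
      case 3
      have "fst m \<in> \<Phi>" "opp_dom (fst m) \<notin> snd m" using 3 by (auto simp: M_def)
      then have "vmap (fst m) (opp_dom (fst m)) \<notin> vmap (fst m) ` snd m"
        using pseudomanifold_inj[OF \<Phi>, of "fst m" UNIV] by (simp add: inj_image_mem_iff)
      then show ?thesis using 3 st(2)[of m] by (auto simp: t_def split: prod.split)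
    qed
  qed
  have finU: "finite U" by (simp add: U_def)
  have finDC: "finite D" "finite C" "finite (D \<union> C)" using finM by (simp_all add: D_def C_def)
  have "card (- snd p) = 2" if "p \<in> e" for p
    using card_edge_member[OF \<Phi> e, of "fst p" "snd p"] that
    by (simp add: Compl_eq_Diff_UNIV card_Diff_subset)
  then have "card (Sigma e (\<lambda>p. - snd p)) = (\<Sum>p\<in>e. 2)"
    by (subst card_SigmaI) simp_all
  then have "2 * card e = card U + 2 * card M"
    unfolding P using card_Un_disjoint[OF finU finDC(3) U_DC] card_Un_disjoint[OF finDC(1,2) DC] cD cC
    by simp
  then have "card U = 2 * (card e - card M)" by simp
  moreover have "card e - card M = 0 \<or> card e - card M = 1" using le by linarith
  ultimately have card_U: "card U = 0 \<or> card U = 2" by auto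
  have "boundary_edge \<Phi> e \<longleftrightarrow> (\<exists>p\<in>e. unpaired_sides \<Phi> p \<noteq> {})"
    unfolding boundary_edge_def unpaired_sides_def by (rule bex_cong) (simp_all add: split_beta)
  then have "boundary_edge \<Phi> e \<longleftrightarrow> U \<noteq> {}" unfolding U_def Sigma_empty_iff by simp
  then have "card U = (if boundary_edge \<Phi> e then 2 else 0)" using card_U finU by (auto simp: card_eq_0_iff)
  then show ?thesis by (simp add: U_def card_SigmaI)
qed

section \<open>The generalised Euler characteristic of a solution\<close>

lemma sum_ndisc:
  fixes f :: "('t::finite) ndisc \<Rightarrow> real"
  shows "(\<Sum>i\<in>UNIV. f i) = (\<Sum>\<sigma>\<in>UNIV. (\<Sum>q\<in>UNIV. f (Quad \<sigma> q)) + (\<Sum>a\<in>UNIV. f (Tri \<sigma> a)))"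
proof -
  have "(\<Sum>i\<in>UNIV. f i) = (\<Sum>p\<in>UNIV \<times> UNIV. f (Inl p)) + (\<Sum>p\<in>UNIV \<times> UNIV. f (Inr p))"
    unfolding UNIV_Plus_UNIV[symmetric] UNIV_Times_UNIV by (subst sum.Plus) (simp_all add: comp_def)
  also have "(\<Sum>p\<in>UNIV \<times> UNIV. f (Inl p)) = (\<Sum>\<sigma>\<in>UNIV. \<Sum>q\<in>UNIV. f (Quad \<sigma> q))"
    unfolding sum.cartesian_product by (simp add: split_def)
  also have "(\<Sum>p\<in>UNIV \<times> UNIV. f (Inr p)) = (\<Sum>\<sigma>\<in>UNIV. \<Sum>a\<in>UNIV. f (Tri \<sigma> a))"
    unfolding sum.cartesian_product by (simp add: split_def)
  finally show ?thesis by (simp add: sum.distrib)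
qed

lemma chi_star_linear:
  "chi_star \<Phi> (x + y) = chi_star \<Phi> x + chi_star \<Phi> y"
  "chi_star \<Phi> (c *\<^sub>R x) = c * chi_star \<Phi> x"
  by (simp_all add: chi_star_def distrib_right sum.distrib sum_distrib_left mult.assoc)

text \<open>
  Here \<open>B\<close> is the set of unpaired faces, \<open>g\<close> the reciprocal degree of the edges.  Grouping by the
  points on the edges: a disc contributes \<open>g E\<close> for every point in which it meets an edge \<open>E\<close>, and an
  arc in an unpaired face, which costs a half, is charged to its two end points, a quarter each.
\<close>

lemma chi_star_tetrahedron:
  fixes x :: "quad \<Rightarrow> real" and y :: "4 \<Rightarrow> real" and g :: "4 set \<Rightarrow> real" and B :: "4 set"
  shows "(\<Sum>q\<in>UNIV. x q * (- 1 / 2 * (2 + real (card B)) + (\<Sum>E | card E = 2 \<and> E \<notin> quad_edges q. g E))) +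
      (\<Sum>a\<in>UNIV. y a * (- 1 / 2 * (1 + real (card (B - {a}))) + (\<Sum>E | card E = 2 \<and> a \<in> E. g E))) =
    (\<Sum>E | card E = 2. ((\<Sum>a\<in>E. y a) + (\<Sum>q\<in>-{facing_quad E}. x q)) * (g E - real (card (B - E)) / 4))
      - ((\<Sum>a\<in>UNIV. y a) / 2 + (\<Sum>q\<in>UNIV. x q))"
proof -
  have d: "distinct [1, 2, 3, 4 :: 4]" by simp
  have d2: "distinct [2, 1, 3, 4 :: 4]" by simp
  have d3: "distinct [3, 1, 2, 4 :: 4]" by simp
  have d4: "distinct [4, 1, 2, 3 :: 4]" by simp
  define b :: "4 \<Rightarrow> real" where "b v = of_bool (v \<in> B)" for v
  have card_b: "real (card (B - A)) = (\<Sum>v\<in>UNIV. if v \<in> A then 0 else b v)" for A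
  proof -
    have "(\<Sum>v\<in>UNIV. if v \<in> A then 0 else b v) = (\<Sum>v\<in>UNIV. if v \<in> B - A then 1 else 0)"
      by (intro sum.cong) (auto simp: b_def)
    then show ?thesis by (simp add: sum.If_cases set_diff_eq)
  qed
  have cB: "real (card B) = b 1 + b 2 + b 3 + b 4"
    using card_b[of "{}"] sum_labels[OF d, of b] by simp
  have not_quad: "(\<Sum>E | card E = 2 \<and> E \<notin> quad_edges q. g E) =
      (\<Sum>E | card E = 2. g E) - (\<Sum>E\<in>quad_edges q. g E)" for q
  proof -
    have "{E. card E = 2 \<and> E \<notin> quad_edges q} = {E. card E = 2} - quad_edges q" by auto
    moreover have "quad_edges q \<subseteq> {E. card E = 2}" using quad_edges_iff by auto
    ultimately show ?thesis by (simp only: sum_diff[OF finite])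
  qed
  have quad_compl: "- {Q12_34} = {Q13_24, Q14_23}" "- {Q13_24} = {Q12_34, Q14_23}"
    "- {Q14_23} = {Q12_34, Q13_24}" using UNIV_quad by auto
  show ?thesis
    unfolding not_quad sum_quads[OF d] sum_labels[OF d] sum_pairs[OF d] facing_quad_simps
      sum_pairs_through[OF d] sum_pairs_through[OF d2] sum_pairs_through[OF d3] sum_pairs_through[OF d4]
      cB card_b quad_compl
    by (simp add: doubleton_eq_iff insert_commute) (simp add: field_simps)
qed

lemma chi_star_eq:
  "chi_star \<Phi> s = (\<Sum>\<sigma>\<in>UNIV. \<Sum>E | card E = 2. edge_weight s (\<sigma>, E) *
      (1 / real (degree (edge_class \<Phi> \<sigma> E)) - real (card (unpaired_sides \<Phi> (\<sigma>, E))) / 4))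
    - (\<Sum>\<sigma>\<in>UNIV. (\<Sum>a\<in>UNIV. s $ Tri \<sigma> a) / 2 + (\<Sum>q\<in>UNIV. s $ Quad \<sigma> q))"
  (is "_ = ?R")
proof -
  have "(\<Sum>q\<in>UNIV. s $ Quad \<sigma> q * chi_star_disc \<Phi> (Quad \<sigma> q)) +
      (\<Sum>a\<in>UNIV. s $ Tri \<sigma> a * chi_star_disc \<Phi> (Tri \<sigma> a)) =
    (\<Sum>E | card E = 2. edge_weight s (\<sigma>, E) *
      (1 / real (degree (edge_class \<Phi> \<sigma> E)) - real (card (unpaired_sides \<Phi> (\<sigma>, E))) / 4))
    - ((\<Sum>a\<in>UNIV. s $ Tri \<sigma> a) / 2 + (\<Sum>q\<in>UNIV. s $ Quad \<sigma> q))" for \<sigma>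
  proof -
    define B where "B = {v. (\<sigma>, v) \<in> unpaired_faces \<Phi>}"
    have "{v. v \<noteq> a \<and> (\<sigma>, v) \<in> unpaired_faces \<Phi>} = B - {a}" for a by (auto simp: B_def)
    moreover have "unpaired_sides \<Phi> (\<sigma>, E) = B - E" for E by (auto simp: unpaired_sides_def B_def)
    ultimately show ?thesis
      unfolding chi_star_disc.simps edge_weight_def prod.case
      using chi_star_tetrahedron[of "\<lambda>q. s $ Quad \<sigma> q" B "\<lambda>E. 1 / real (degree (edge_class \<Phi> \<sigma> E))"
          "\<lambda>a. s $ Tri \<sigma> a"]
      by (simp only: flip: B_def)
  qed
  then show ?thesis unfolding chi_star_def sum_ndisc by (simp only: sum_subtractf)
qed

text \<open>
  The weight along \<open>e\<close> is \<open>2 * z e\<close>.  Over the copies of \<open>e\<close> the terms \<open>1 / degree\<close> add up to 1, and the quarters for unpaired faces to 0 or a half.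
  The constant term of \<open>\<chi>\<^sup>*\<close> is minus half the number of triangles minus the number of
  quadrilaterals; it vanishes on every \<open>W\<^sub>e\<close> and is \<open>- 4 / 2 + 3 = 1\<close> on \<open>W\<^sub>\<sigma>\<close>.
\<close>

lemma chi_star_W_combination:
  assumes \<Phi>: "triangulated_pseudomanifold \<Phi>"
  shows "chi_star \<Phi> (W_combination \<Phi> w z) =
    (\<Sum>\<sigma>\<in>UNIV. w \<sigma>) + (\<Sum>e\<in>edges \<Phi>. z e * (if boundary_edge \<Phi> e then 1 else 2))"
proof -
  let ?s = "W_combination \<Phi> w z"
  let ?f = "\<lambda>p. 2 * z (edge_class \<Phi> (fst p) (snd p)) *
    (1 / real (degree (edge_class \<Phi> (fst p) (snd p))) - real (card (unpaired_sides \<Phi> p)) / 4)"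
  have "(\<Sum>\<sigma>\<in>UNIV. \<Sum>E | card E = 2. edge_weight ?s (\<sigma>, E) *
      (1 / real (degree (edge_class \<Phi> \<sigma> E)) - real (card (unpaired_sides \<Phi> (\<sigma>, E))) / 4)) =
    (\<Sum>\<sigma>\<in>UNIV. \<Sum>E | card E = 2. ?f (\<sigma>, E))"
    by (intro sum.cong refl) (simp add: edge_weight_W_combination[OF \<Phi>])
  also have "\<dots> = (\<Sum>e\<in>edges \<Phi>. \<Sum>p\<in>e. ?f p)" by (rule sum_edges[OF \<Phi>, symmetric])
  also have "\<dots> = (\<Sum>e\<in>edges \<Phi>. z e * (if boundary_edge \<Phi> e then 1 else 2))"
  proof (rule sum.cong[OF refl])
    fix e assume e: "e \<in> edges \<Phi>"
    then have "e \<noteq> {}" using edge_nonempty by blast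
    have "(\<Sum>p\<in>e. ?f p) = (\<Sum>p\<in>e. 2 * z e * (1 / real (card e) - real (card (unpaired_sides \<Phi> p)) / 4))"
      by (intro sum.cong refl) (simp add: edge_classI[OF e] degree_def)
    also have "\<dots> = 2 * z e * (\<Sum>p\<in>e. 1 / real (card e) - real (card (unpaired_sides \<Phi> p)) / 4)"
      by (simp only: sum_distrib_left)
    also have "(\<Sum>p\<in>e. 1 / real (card e) - real (card (unpaired_sides \<Phi> p)) / 4) =
      1 - real (\<Sum>p\<in>e. card (unpaired_sides \<Phi> p)) / 4"
      using \<open>e \<noteq> {}\<close> by (simp add: sum_subtractf sum_divide_distrib[symmetric])
    finally show "(\<Sum>p\<in>e. ?f p) = z e * (if boundary_edge \<Phi> e then 1 else 2)"
      unfolding sum_card_unpaired_sides[OF \<Phi> e] by simp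
  qed
  finally have 1: "(\<Sum>\<sigma>\<in>UNIV. \<Sum>E | card E = 2. edge_weight ?s (\<sigma>, E) *
      (1 / real (degree (edge_class \<Phi> \<sigma> E)) - real (card (unpaired_sides \<Phi> (\<sigma>, E))) / 4)) =
    (\<Sum>e\<in>edges \<Phi>. z e * (if boundary_edge \<Phi> e then 1 else 2))" .
  have d: "distinct [1, 2, 3, 4 :: 4]" "distinct [2, 1, 3, 4 :: 4]" "distinct [3, 1, 2, 4 :: 4]"
    "distinct [4, 1, 2, 3 :: 4]" "distinct [1, 3, 2, 4 :: 4]" "distinct [1, 4, 2, 3 :: 4]" by simp_all
  have 2: "(\<Sum>a\<in>UNIV. ?s $ Tri \<sigma> a) / 2 + (\<Sum>q\<in>UNIV. ?s $ Quad \<sigma> q) = - w \<sigma>" for \<sigma>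
    unfolding W_combination_eq_local_combination[OF \<Phi>] sum_labels[OF d(1)] sum_quads[OF d(1)]
      local_combination_Tri[OF d(1)] local_combination_Tri[OF d(2)] local_combination_Tri[OF d(3)] local_combination_Tri[OF d(4)]
      local_combination_Quad[OF d(1)] local_combination_Quad[OF d(5)] local_combination_Quad[OF d(6)]
    by (simp add: insert_commute field_simps)
  show ?thesis unfolding chi_star_eq 1 2 by (simp add: sum_negf)
qed

section \<open>The Euler characteristic of a vertex link\<close>

lemma symcl_rtrancl_map:
  assumes "(p, q) \<in> (R \<union> R\<inverse>)\<^sup>*" "\<And>p q. (p, q) \<in> R \<Longrightarrow> (f p, f q) \<in> Q"
  shows "(f p, f q) \<in> (Q \<union> Q\<inverse>)\<^sup>*"
  using assms(1)
proof (induction rule: rtrancl_induct)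
  case (step y z)
  then have "(f y, f z) \<in> Q \<union> Q\<inverse>" using assms(2) by blast
  with step.IH show ?case by (rule rtrancl.rtrancl_into_rtrancl)
qed simp

lemma flag_ident_cells:
  assumes "((\<sigma>, a, S), (\<tau>, b, T)) \<in> flag_ident \<Phi>"
  shows "((\<sigma>, S), (\<tau>, T)) \<in> cell_ident \<Phi>" "((\<sigma>, {a}), (\<tau>, {b})) \<in> cell_ident \<Phi>"
proof -
  have "(case (\<sigma>, a, S) of (\<sigma>, a, S) \<Rightarrow> (\<sigma>, S), case (\<tau>, b, T) of (\<sigma>, a, S) \<Rightarrow> (\<sigma>, S)) \<in> cell_ident \<Phi>"
    using assms unfolding flag_ident_def cell_ident_def
    by (rule symcl_rtrancl_map) (auto simp: flag_glue_def cell_glue_def)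
  then show "((\<sigma>, S), (\<tau>, T)) \<in> cell_ident \<Phi>" by simp
  have "(case (\<sigma>, a, S) of (\<sigma>, a, S) \<Rightarrow> (\<sigma>, {a}), case (\<tau>, b, T) of (\<sigma>, a, S) \<Rightarrow> (\<sigma>, {a})) \<in> cell_ident \<Phi>"
    using assms unfolding flag_ident_def cell_ident_def
  proof (rule symcl_rtrancl_map)
    fix p q assume "(p, q) \<in> flag_glue \<Phi>"
    then obtain \<phi> a S where "p = (tet_dom \<phi>, a, S)" "q = (tet_cod \<phi>, vmap \<phi> a, vmap \<phi> ` S)"
      "\<phi> \<in> \<Phi>" "opp_dom \<phi> \<notin> {a}" by (auto simp: flag_glue_def)
    then show "(case p of (\<sigma>, a, S) \<Rightarrow> (\<sigma>, {a}), case q of (\<sigma>, a, S) \<Rightarrow> (\<sigma>, {a})) \<in> cell_glue \<Phi>"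
      by (force simp: cell_glue_def)
  qed
  then show "((\<sigma>, {a}), (\<tau>, {b})) \<in> cell_ident \<Phi>" by simp
qed

lemma flag_ident_corner:
  assumes "((\<sigma>, a, S), (\<tau>, b, T)) \<in> flag_ident \<Phi>"
  shows "a \<in> S \<longleftrightarrow> b \<in> T"
proof -
  have "(case (\<sigma>, a, S) of (\<sigma>, a, S) \<Rightarrow> a \<in> S) = (case (\<tau>, b, T) of (\<sigma>, a, S) \<Rightarrow> a \<in> S)"
    using assms unfolding flag_ident_def
    by (rule symcl_rtrancl_invariant) (auto simp: flag_glue_def)
  then show ?thesis by simp
qed

lemma flag_glue_ident: "(f, g) \<in> flag_glue \<Phi> \<Longrightarrow> (f, g) \<in> flag_ident \<Phi> \<and> (g, f) \<in> flag_ident \<Phi>"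
  by (auto simp: flag_ident_def)

lemma flag_ident_sym: "(f, g) \<in> flag_ident \<Phi> \<Longrightarrow> (g, f) \<in> flag_ident \<Phi>"
  using equiv_flag_ident by (auto simp: equiv_def dest: symD)

lemma flag_ident_trans: "(f, g) \<in> flag_ident \<Phi> \<Longrightarrow> (g, h) \<in> flag_ident \<Phi> \<Longrightarrow> (f, h) \<in> flag_ident \<Phi>"
  using equiv_flag_ident by (auto simp: equiv_def dest: transD)

lemma flag_ident_lift:
  assumes "(p, q) \<in> cell_ident \<Phi>" "a \<in> snd p"
  shows "\<exists>b\<in>snd q. ((fst p, a, snd p), (fst q, b, snd q)) \<in> flag_ident \<Phi>"
  using assms(1) unfolding cell_ident_def
proof (induction rule: rtrancl_induct)
  case base
  then show ?case using assms(2) by (intro bexI[of _ a]) (simp add: flag_ident_def)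
next
  case (step q r)
  then obtain b where b: "b \<in> snd q" "((fst p, a, snd p), (fst q, b, snd q)) \<in> flag_ident \<Phi>" by blast
  from step(2) have "\<exists>c\<in>snd r. ((fst q, b, snd q), (fst r, c, snd r)) \<in> flag_ident \<Phi>"
  proof
    assume "(q, r) \<in> cell_glue \<Phi>"
    then obtain \<phi> S where qr: "q = (tet_dom \<phi>, S)" "r = (tet_cod \<phi>, vmap \<phi> ` S)" "\<phi> \<in> \<Phi>" "opp_dom \<phi> \<notin> S"
      by (auto simp: cell_glue_def)
    then have "((fst q, b, snd q), (fst r, vmap \<phi> b, snd r)) \<in> flag_glue \<Phi>"
      using b(1) by (force simp: flag_glue_def)
    then show ?thesis using flag_glue_ident qr b(1) by fastforce
  next
    assume "(q, r) \<in> (cell_glue \<Phi>)\<inverse>"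
    then obtain \<phi> S where qr: "r = (tet_dom \<phi>, S)" "q = (tet_cod \<phi>, vmap \<phi> ` S)" "\<phi> \<in> \<Phi>" "opp_dom \<phi> \<notin> S"
      by (auto simp: cell_glue_def)
    then obtain c where c: "c \<in> S" "b = vmap \<phi> c" using b(1) by auto
    then have "((fst r, c, snd r), (fst q, b, snd q)) \<in> flag_glue \<Phi>"
      using qr by (force simp: flag_glue_def)
    then show ?thesis using flag_glue_ident qr c by fastforce
  qed
  then show ?case using b(2) flag_ident_trans by blast
qed

text \<open>
  Forgetting the chosen end maps the copies of a point of a link onto the copies of the edge that
  contains it.  No two copies of the point lie on the same copy of the edge, because no edge is
  identified with itself in reverse.
\<close>

lemma card_flag_class_edge:
  assumes \<Phi>: "triangulated_pseudomanifold \<Phi>" and E: "card E = 2" "a \<in> E"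
  shows "card (flag_ident \<Phi> `` {(\<sigma>, a, E)}) = degree (edge_class \<Phi> \<sigma> E)"
proof -
  let ?C = "flag_ident \<Phi> `` {(\<sigma>, a, E)}"
  let ?h = "\<lambda>(\<tau>, b, F). (\<tau>, F)"
  have "inj_on ?h ?C"
  proof (rule inj_onI)
    fix f g assume fg: "f \<in> ?C" "g \<in> ?C" "?h f = ?h g"
    then obtain \<tau> b c F where fg_eq: "f = (\<tau>, b, F)" "g = (\<tau>, c, F)" by (cases f; cases g) auto
    have b: "((\<sigma>, a, E), (\<tau>, b, F)) \<in> flag_ident \<Phi>" and c: "((\<sigma>, a, E), (\<tau>, c, F)) \<in> flag_ident \<Phi>"
      using fg(1,2) unfolding fg_eq by auto
    have bc: "((\<tau>, b, F), (\<tau>, c, F)) \<in> flag_ident \<Phi>" using flag_ident_trans[OF flag_ident_sym[OF b] c] .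
    have "card F = 2" using cell_ident_card[OF \<Phi> flag_ident_cells(1)[OF b]] E by simp
    moreover have "b \<in> F" "c \<in> F" using flag_ident_corner[OF b] flag_ident_corner[OF c] E by auto
    ultimately have "b \<noteq> c \<Longrightarrow> F = {b, c}" by (auto simp: card_2_iff)
    moreover have "a \<noteq> b \<Longrightarrow> ((\<sigma>, a, {a, b}), (\<sigma>, b, {a, b})) \<notin> flag_ident \<Phi>" for \<sigma> a b
      using \<Phi>[unfolded triangulated_pseudomanifold_def, THEN conjunct2, THEN conjunct2] by blast
    ultimately show "f = g" unfolding fg_eq using bc by blast
  qed
  moreover have "?h ` ?C = edge_class \<Phi> \<sigma> E"
  proof (intro equalityI subsetI)
    fix p assume "p \<in> ?h ` ?C"
    then show "p \<in> edge_class \<Phi> \<sigma> E" using flag_ident_cells(1) by (fastforce simp: edge_class_def)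
  next
    fix p assume "p \<in> edge_class \<Phi> \<sigma> E"
    then have "((\<sigma>, E), p) \<in> cell_ident \<Phi>" by (simp add: edge_class_def)
    from flag_ident_lift[OF this, of a] E obtain b where "(fst p, b, snd p) \<in> ?C" by auto
    then show "p \<in> ?h ` ?C" by (rule rev_image_eqI) simp
  qed
  ultimately show ?thesis unfolding degree_def by (metis card_image)
qed

lemma arc_glue_dom:
  assumes "((\<sigma>, a, - {v}), g) \<in> flag_glue \<Phi>"
  obtains \<phi> where "\<phi> \<in> \<Phi>" "dom_face \<phi> = (\<sigma>, v)" "g = (tet_cod \<phi>, vmap \<phi> a, vmap \<phi> ` (- {v}))"
  using assms by (auto simp: flag_glue_def dom_face_def)

lemma arc_glue_cod:
  assumes \<Phi>: "triangulated_pseudomanifold \<Phi>" and g: "(g, (\<sigma>, a, - {v})) \<in> flag_glue \<Phi>"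
  obtains \<phi> where "\<phi> \<in> \<Phi>" "cod_face \<phi> = (\<sigma>, v)"
    "g = (tet_dom \<phi>, inv (vmap \<phi>) a, inv (vmap \<phi>) ` (- {v}))"
proof -
  from g obtain \<phi> b S where \<phi>: "\<phi> \<in> \<Phi>" "opp_dom \<phi> \<notin> S" "g = (tet_dom \<phi>, b, S)"
    "\<sigma> = tet_cod \<phi>" "a = vmap \<phi> b" "- {v} = vmap \<phi> ` S" by (auto simp: flag_glue_def)
  have inj: "inj (vmap \<phi>)" by (rule pseudomanifold_inj[OF \<Phi> \<phi>(1)])
  then have "vmap \<phi> (opp_dom \<phi>) \<notin> - {v}" unfolding \<phi>(6) using \<phi>(2) by (simp add: inj_image_mem_iff)
  then have "cod_face \<phi> = (\<sigma>, v)" using \<phi>(4) by (simp add: cod_face_def)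
  moreover have "g = (tet_dom \<phi>, inv (vmap \<phi>) a, inv (vmap \<phi>) ` (- {v}))"
    unfolding \<phi>(3,5,6) using inj by (simp add: image_comp comp_def)
  ultimately show thesis using that \<phi>(1) by blast
qed

text \<open>
  A face belongs to at most one pairing and is never paired with itself, so an arc in a paired face has
  exactly one other copy.
\<close>

lemma card_flag_class_arc:
  assumes \<Phi>: "triangulated_pseudomanifold \<Phi>" and a: "a \<noteq> v"
  shows "card (flag_ident \<Phi> `` {(\<sigma>, a, - {v})}) = (if (\<sigma>, v) \<in> unpaired_faces \<Phi> then 1 else 2)"
proof -
  let ?R = "flag_glue \<Phi> \<union> (flag_glue \<Phi>)\<inverse>"
  have unique: "g = h" if "((\<sigma>, a, - {v}), g) \<in> ?R" "((\<sigma>, a, - {v}), h) \<in> ?R" for g h \<sigma> a v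
    using that
    by (auto elim!: arc_glue_dom arc_glue_cod[OF \<Phi>]
        dest: pseudomanifold_faces[OF \<Phi>] pseudomanifold_faces(1)[OF \<Phi>, THEN not_sym])
  let ?x = "(\<sigma>, a, - {v})"
  show ?thesis
  proof (cases "(\<sigma>, v) \<in> unpaired_faces \<Phi>")
    case True
    then have no: "(?x, g) \<notin> ?R" for g
      by (auto simp: unpaired_faces_def elim!: arc_glue_dom arc_glue_cod[OF \<Phi>])
    have "g = ?x" if "(?x, g) \<in> ?R\<^sup>*" for g
      using that by (induction rule: rtrancl_induct) (use no in blast)+
    then have "flag_ident \<Phi> `` {?x} = {?x}" by (auto simp: flag_ident_def)
    then show ?thesis using True by simp
  next
    case False
    then obtain \<phi> where \<phi>: "\<phi> \<in> \<Phi>" and "(\<sigma>, v) = dom_face \<phi> \<or> (\<sigma>, v) = cod_face \<phi>"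
      by (auto simp: unpaired_faces_def)
    then consider "\<sigma> = tet_dom \<phi>" "v = opp_dom \<phi>" | "\<sigma> = tet_cod \<phi>" "v = vmap \<phi> (opp_dom \<phi>)"
      by (auto simp: dom_face_def cod_face_def)
    then have "\<exists>y. (?x, y) \<in> ?R"
    proof cases
      case 1
      then have "(?x, (tet_cod \<phi>, vmap \<phi> a, vmap \<phi> ` (- {v}))) \<in> flag_glue \<Phi>"
        using a \<phi> by (auto simp: flag_glue_def)
      then show ?thesis by blast
    next
      case 2
      have bij: "bij (vmap \<phi>)" by (rule pseudomanifold_bij[OF \<Phi> \<phi>])
      have "vmap \<phi> (inv (vmap \<phi>) a) = a" "vmap \<phi> ` (vmap \<phi> -` (- {v})) = - {v}"
        using bij by (simp_all add: bij_is_surj surj_f_inv_f surj_image_vimage_eq)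
      then have "((tet_dom \<phi>, inv (vmap \<phi>) a, vmap \<phi> -` (- {v})), ?x) \<in> flag_glue \<Phi>"
        using a \<phi> 2 unfolding flag_glue_def
        by (intro CollectI exI[of _ \<phi>] exI[of _ "inv (vmap \<phi>) a"] exI[of _ "vmap \<phi> -` (- {v})"]) simp
      then show ?thesis by blast
    qed
    then obtain y where y: "(?x, y) \<in> ?R" by blast
    obtain \<tau> b T where yT: "y = (\<tau>, b, T)" by (cases y)
    have "(?x, y) \<in> flag_ident \<Phi>" unfolding flag_ident_def using y by blast
    then have "card T = card (- {v})"
      using cell_ident_card[OF \<Phi> flag_ident_cells(1)] unfolding yT by fastforce
    then have "card (- T) = 1" by (simp add: Compl_eq_Diff_UNIV card_Diff_subset)
    then obtain w where "- T = {w}" by (rule card_1_singletonE)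
    then have T: "T = - {w}" by blast
    have ne: "y \<noteq> ?x"
    proof
      assume "y = ?x"
      then have loop: "(?x, ?x) \<in> flag_glue \<Phi>" using y by blast
      obtain \<phi> where "\<phi> \<in> \<Phi>" "dom_face \<phi> = (\<sigma>, v)" using loop by (rule arc_glue_dom)
      moreover obtain \<psi> where "\<psi> \<in> \<Phi>" "cod_face \<psi> = (\<sigma>, v)" using \<Phi> loop by (rule arc_glue_cod)
      ultimately show False using pseudomanifold_faces(1)[OF \<Phi>] by metis
    qed
    have "g = ?x \<or> g = y" if "(?x, g) \<in> ?R\<^sup>*" for g
      using that
    proof (induction rule: rtrancl_induct)
      case (step g h)
      have "(y, ?x) \<in> ?R" using y by blast
      then show ?case using step unique[OF y, of h] unique[of \<tau> b w ?x h] unfolding yT T by blast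
    qed simp
    then have "flag_ident \<Phi> `` {?x} = {?x, y}"
      using \<open>(?x, y) \<in> flag_ident \<Phi>\<close> by (auto simp: flag_ident_def)
    then show ?thesis using False ne by simp
  qed
qed

lemma chi_star_normal_coordinate:
  "chi_star \<Phi> (normal_coordinate S) = (\<Sum>(\<sigma>, a)\<in>S. chi_star_disc \<Phi> (Tri \<sigma> a))"
proof -
  have lin: "linear (chi_star \<Phi>)" by (intro linearI) (simp_all add: chi_star_linear)
  have "chi_star \<Phi> (axis i 1) = chi_star_disc \<Phi> i" for i
    by (simp add: chi_star_def axis_def if_distrib[of "\<lambda>x. x * _"] cong: if_cong)
  then show ?thesis
    unfolding normal_coordinate_def linear_sum[OF lin] by (intro sum.cong) auto
qed

lemma sum_flags:
  fixes f :: "('t::finite) \<times> 4 \<times> 4 set \<Rightarrow> real"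
  shows "(\<Sum>x\<in>{(\<sigma>, a, E). (\<sigma>, a) \<in> S \<and> P a E}. f x) = (\<Sum>(\<sigma>, a)\<in>S. \<Sum>E | P a E. f (\<sigma>, a, E))"
proof -
  let ?h = "\<lambda>((\<sigma>, a), E). (\<sigma>, a, E)"
  have "{(\<sigma>, a, E). (\<sigma>, a) \<in> S \<and> P a E} = ?h ` Sigma S (\<lambda>(\<sigma>, a). {E. P a E})" by force
  moreover have "inj_on ?h (Sigma S (\<lambda>(\<sigma>, a). {E. P a E}))" by (auto simp: inj_on_def)
  ultimately have "(\<Sum>x\<in>{(\<sigma>, a, E). (\<sigma>, a) \<in> S \<and> P a E}. f x) =
    (\<Sum>x\<in>Sigma S (\<lambda>(\<sigma>, a). {E. P a E}). f (?h x))" by (simp add: sum.reindex)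
  also have "\<dots> = (\<Sum>p\<in>S. \<Sum>E\<in>(case p of (\<sigma>, a) \<Rightarrow> {E. P a E}). f (?h (p, E)))"
    by (subst sum.Sigma) (auto simp: split_def)
  finally show ?thesis by (simp add: split_def)
qed

lemma vertex_link_flag_closed:
  assumes "v \<in> vertices \<Phi>" "((\<sigma>, a, S), (\<tau>, b, T)) \<in> flag_ident \<Phi>" "(\<sigma>, a) \<in> vertex_link v"
  shows "(\<tau>, b) \<in> vertex_link v"
proof -
  obtain p where v: "v = cell_ident \<Phi> `` {p}" using assms(1) unfolding vertices_def by (rule quotientE)
  have "(p, (\<sigma>, {a})) \<in> cell_ident \<Phi>" using assms(3) by (simp add: v vertex_link_def)
  then have "(p, (\<tau>, {b})) \<in> cell_ident \<Phi>"
    using flag_ident_cells(2)[OF assms(2)] unfolding cell_ident_def by (rule rtrancl_trans)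
  then show ?thesis by (simp add: v vertex_link_def)
qed

text \<open>
  Counting points and arcs of the link by their copies, each triangle receives a share of \<open>1 / d(e)\<close>
  from its point on the edge \<open>e\<close>, and a share of 1 or \<open>1 / 2\<close> from an arc, depending on whether the arc
  lies in the boundary.
\<close>

theorem euler_char_vertex_link:
  fixes \<Phi> :: "('t::finite) pairing set"
  assumes \<Phi>: "triangulated_pseudomanifold \<Phi>" and v: "v \<in> vertices \<Phi>"
  shows "real_of_int (euler_char \<Phi> (vertex_link v)) = chi_star \<Phi> (normal_coordinate (vertex_link v))"
proof -
  let ?S = "vertex_link v"
  have card_eq: "real (card ({(\<sigma>, a, E). (\<sigma>, a) \<in> ?S \<and> a \<in> E \<and> card E = k} // flag_ident \<Phi>)) =
    (\<Sum>(\<sigma>, a)\<in>?S. \<Sum>E | a \<in> E \<and> card E = k. 1 / real (card (flag_ident \<Phi> `` {(\<sigma>, a, E)})))" for k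
  proof -
    have "(\<tau>, b) \<in> ?S \<and> b \<in> F \<and> card F = k"
      if "(\<sigma>, a) \<in> ?S" "a \<in> E" "card E = k" "((\<sigma>, a, E), (\<tau>, b, F)) \<in> flag_ident \<Phi>" for \<sigma> a E \<tau> b F
      using that vertex_link_flag_closed[OF v that(4)] flag_ident_corner[OF that(4)]
        cell_ident_card[OF \<Phi> flag_ident_cells(1)[OF that(4)]] by simp
    then have "flag_ident \<Phi> `` {(\<sigma>, a, E). (\<sigma>, a) \<in> ?S \<and> a \<in> E \<and> card E = k}
        \<subseteq> {(\<sigma>, a, E). (\<sigma>, a) \<in> ?S \<and> a \<in> E \<and> card E = k}" by blast
    from card_quotient[OF equiv_flag_ident finite this] show ?thesis unfolding sum_flags .
  qed
  have points: "real (card (surface_points \<Phi> ?S)) =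
    (\<Sum>(\<sigma>, a)\<in>?S. \<Sum>E | card E = 2 \<and> a \<in> E. 1 / real (degree (edge_class \<Phi> \<sigma> E)))"
    unfolding surface_points_def card_eq
    by (intro sum.cong refl) (auto simp: card_flag_class_edge[OF \<Phi>] conj_commute intro!: sum.cong)
  have arcs_at: "(\<Sum>F | a \<in> F \<and> card F = 3. 1 / real (card (flag_ident \<Phi> `` {(\<sigma>, a, F)}))) =
    3 / 2 + real (card {v. v \<noteq> a \<and> (\<sigma>, v) \<in> unpaired_faces \<Phi>}) / 2" for \<sigma> a
  proof -
    have "{F. a \<in> F \<and> card F = 3} = (\<lambda>v. - {v}) ` (- {a})"
    proof (intro equalityI subsetI)
      fix F assume "F \<in> {F. a \<in> F \<and> card F = 3}"
      then have F: "a \<in> F" "card (- F) = 1" by (simp_all add: Compl_eq_Diff_UNIV card_Diff_subset)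
      from F(2) obtain v where "- F = {v}" by (rule card_1_singletonE)
      then have "F = - {v}" "v \<in> - {a}" using F(1) by blast+
      then show "F \<in> (\<lambda>v. - {v}) ` (- {a})" by blast
    qed (auto simp: Compl_eq_Diff_UNIV card_Diff_subset)
    moreover have "inj_on (\<lambda>v. - {v}) (- {a})" by (auto simp: inj_on_def)
    ultimately have "(\<Sum>F | a \<in> F \<and> card F = 3. 1 / real (card (flag_ident \<Phi> `` {(\<sigma>, a, F)}))) =
      (\<Sum>v\<in>-{a}. 1 / real (card (flag_ident \<Phi> `` {(\<sigma>, a, - {v})})))" by (simp add: sum.reindex)
    also have "\<dots> = (\<Sum>v\<in>-{a}. 1 / 2 + (if (\<sigma>, v) \<in> unpaired_faces \<Phi> then 1 / 2 else 0))"
      by (intro sum.cong) (auto simp: card_flag_class_arc[OF \<Phi>])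
    also have "\<dots> = 3 / 2 + (\<Sum>v\<in>-{a}. if (\<sigma>, v) \<in> unpaired_faces \<Phi> then 1 / 2 else 0)"
      by (simp add: sum.distrib Compl_eq_Diff_UNIV card_Diff_subset)
    also have "(\<Sum>v\<in>-{a}. if (\<sigma>, v) \<in> unpaired_faces \<Phi> then 1 / 2 else 0 :: real) =
      real (card {v. v \<noteq> a \<and> (\<sigma>, v) \<in> unpaired_faces \<Phi>}) / 2"
      by (simp add: sum.If_cases Int_def)
    finally show ?thesis .
  qed
  have arcs: "real (card (surface_arcs \<Phi> ?S)) =
    (\<Sum>(\<sigma>, a)\<in>?S. 3 / 2 + real (card {v. v \<noteq> a \<and> (\<sigma>, v) \<in> unpaired_faces \<Phi>}) / 2)"
    unfolding surface_arcs_def card_eq arcs_at ..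
  have triangles: "real (card ?S) = (\<Sum>(\<sigma>, a)\<in>?S. 1)" by (simp add: split_def)
  have "real_of_int (euler_char \<Phi> ?S) =
    real (card (surface_points \<Phi> ?S)) - real (card (surface_arcs \<Phi> ?S)) + real (card ?S)"
    by (simp add: euler_char_def)
  also have "\<dots> = (\<Sum>(\<sigma>, a)\<in>?S. chi_star_disc \<Phi> (Tri \<sigma> a))"
    unfolding points arcs triangles sum_subtractf[symmetric] sum.distrib[symmetric]
    by (intro sum.cong refl) (auto simp: field_simps)
  finally show ?thesis unfolding chi_star_normal_coordinate .
qed

section \<open>Angle structures as representations of a linear functional\<close>

lemma subspace_matching_space: "subspace (matching_space \<Phi>)"
proof -
  have eq: "x $ Quad (tet_dom \<phi>) (facing_quad {opp_dom \<phi>, a}) + x $ Tri (tet_dom \<phi>) a =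
      x $ Quad (tet_cod \<phi>) (facing_quad {vmap \<phi> (opp_dom \<phi>), vmap \<phi> a}) + x $ Tri (tet_cod \<phi>) (vmap \<phi> a)"
    if "x \<in> matching_space \<Phi>" "\<phi> \<in> \<Phi>" "a \<noteq> opp_dom \<phi>" for x \<phi> a
    using that by (auto simp: matching_space_def)
  show ?thesis
  proof (rule subspaceI)
    show "0 \<in> matching_space \<Phi>" by (simp add: matching_space_def)
  next
    fix x y assume xy: "x \<in> matching_space \<Phi>" "y \<in> matching_space \<Phi>"
    show "x + y \<in> matching_space \<Phi>"
      unfolding matching_space_def
    proof (intro CollectI ballI allI impI)
      fix \<phi> a assume "\<phi> \<in> \<Phi>" "a \<noteq> opp_dom \<phi>"
      from eq[OF xy(1) this] eq[OF xy(2) this]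
      show "(x + y) $ Quad (tet_dom \<phi>) (facing_quad {opp_dom \<phi>, a}) + (x + y) $ Tri (tet_dom \<phi>) a =
        (x + y) $ Quad (tet_cod \<phi>) (facing_quad {vmap \<phi> (opp_dom \<phi>), vmap \<phi> a}) +
        (x + y) $ Tri (tet_cod \<phi>) (vmap \<phi> a)"
        unfolding vector_add_component by linarith
    qed
  next
    fix c :: real and x assume x: "x \<in> matching_space \<Phi>"
    show "c *\<^sub>R x \<in> matching_space \<Phi>"
      unfolding matching_space_def
    proof (intro CollectI ballI allI impI)
      fix \<phi> a assume "\<phi> \<in> \<Phi>" "a \<noteq> opp_dom \<phi>"
      then show "(c *\<^sub>R x) $ Quad (tet_dom \<phi>) (facing_quad {opp_dom \<phi>, a}) + (c *\<^sub>R x) $ Tri (tet_dom \<phi>) a =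
        (c *\<^sub>R x) $ Quad (tet_cod \<phi>) (facing_quad {vmap \<phi> (opp_dom \<phi>), vmap \<phi> a}) +
        (c *\<^sub>R x) $ Tri (tet_cod \<phi>) (vmap \<phi> a)"
        unfolding vector_scaleR_component scaleR_add_right[symmetric]
        by (intro arg_cong[of _ _ "(*\<^sub>R) c"] eq[OF x])
    qed
  qed
qed

text \<open>
  The sum of the angles around \<open>e\<close> for which the curvature at \<open>e\<close> is \<open>\<kappa> e\<close>.
\<close>

definition prescribed_angle_sum :: "'t pairing set \<Rightarrow> (('t \<times> 4 set) set \<Rightarrow> real) \<Rightarrow> ('t \<times> 4 set) set \<Rightarrow> real" where
  "prescribed_angle_sum \<Phi> \<kappa> e = (if boundary_edge \<Phi> e then pi else 2 * pi) - \<kappa> e"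

text \<open>
  The factor \<open>\<pi>\<close> makes the coefficients that represent this functional the angles themselves.
\<close>

definition defect :: "'t pairing set \<Rightarrow> (('t \<times> 4 set) set \<Rightarrow> real) \<Rightarrow> real ^ ('t::finite) ndisc \<Rightarrow> real" where
  "defect \<Phi> \<kappa> s = pi * (chi_star \<Phi> s - chi_curv \<Phi> \<kappa> s)"

lemma defect_W_combination:
  assumes "triangulated_pseudomanifold \<Phi>"
  shows "defect \<Phi> \<kappa> (W_combination \<Phi> w z) =
    pi * (\<Sum>\<sigma>\<in>UNIV. w \<sigma>) + (\<Sum>e\<in>edges \<Phi>. z e * prescribed_angle_sum \<Phi> \<kappa> e)"
proof -
  have "(\<Sum>e\<in>edges \<Phi>. z e * prescribed_angle_sum \<Phi> \<kappa> e) =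
    (\<Sum>e\<in>edges \<Phi>. pi * (z e * (if boundary_edge \<Phi> e then 1 else 2)) - z e * \<kappa> e)"
    by (intro sum.cong refl) (simp add: prescribed_angle_sum_def algebra_simps)
  also have "\<dots> = pi * (\<Sum>e\<in>edges \<Phi>. z e * (if boundary_edge \<Phi> e then 1 else 2)) -
    (\<Sum>e\<in>edges \<Phi>. z e * \<kappa> e)"
    by (simp only: sum_subtractf sum_distrib_left)
  finally show ?thesis
    by (simp add: defect_def chi_star_W_combination[OF assms] chi_curv_W_combination[OF assms] algebra_simps)
qed

lemma W_combination_linear:
  "W_combination \<Phi> w z + W_combination \<Phi> w' z' = W_combination \<Phi> (\<lambda>\<sigma>. w \<sigma> + w' \<sigma>) (\<lambda>e. z e + z' e)"
  "c *\<^sub>R W_combination \<Phi> w z = W_combination \<Phi> (\<lambda>\<sigma>. c * w \<sigma>) (\<lambda>e. c * z e)"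
  by (simp_all add: W_combination_def scaleR_add_left sum.distrib scaleR_add_right scaleR_sum_right)

lemma defect_linear:
  assumes \<Phi>: "triangulated_pseudomanifold \<Phi>" and s: "s \<in> matching_space \<Phi>"
  shows "s' \<in> matching_space \<Phi> \<Longrightarrow> defect \<Phi> \<kappa> (s + s') = defect \<Phi> \<kappa> s + defect \<Phi> \<kappa> s'"
    and "defect \<Phi> \<kappa> (c *\<^sub>R s) = c * defect \<Phi> \<kappa> s"
proof -
  obtain w z where s': "s = W_combination \<Phi> w z" using W_combination_exists[OF \<Phi> s] .
  show "defect \<Phi> \<kappa> (c *\<^sub>R s) = c * defect \<Phi> \<kappa> s"
    unfolding s' W_combination_linear defect_W_combination[OF \<Phi>]
    by (simp add: sum_distrib_left algebra_simps)
  assume "s' \<in> matching_space \<Phi>"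
  then obtain w' z' where t: "s' = W_combination \<Phi> w' z'" using W_combination_exists[OF \<Phi>] by metis
  show "defect \<Phi> \<kappa> (s + s') = defect \<Phi> \<kappa> s + defect \<Phi> \<kappa> s'"
    unfolding s' t W_combination_linear defect_W_combination[OF \<Phi>]
    by (simp add: sum.distrib algebra_simps)
qed

lemma defect_sum:
  assumes \<Phi>: "triangulated_pseudomanifold \<Phi>" and "finite A" "\<And>i. i \<in> A \<Longrightarrow> f i \<in> matching_space \<Phi>"
  shows "defect \<Phi> \<kappa> (\<Sum>i\<in>A. c i *\<^sub>R f i) = (\<Sum>i\<in>A. c i * defect \<Phi> \<kappa> (f i))"
  using assms(2,3)
proof (induction A rule: finite_induct)
  case empty
  have "defect \<Phi> \<kappa> (0 *\<^sub>R 0) = 0 * defect \<Phi> \<kappa> 0"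
    by (rule defect_linear(2)[OF \<Phi> subspace_0[OF subspace_matching_space]])
  then show ?case by simp
next
  case (insert i A)
  have mem: "c j *\<^sub>R f j \<in> matching_space \<Phi>" if "j \<in> insert i A" for j
    using insert.prems[OF that] subspace_matching_space by (rule subspace_scale[rotated])
  then have sum: "(\<Sum>j\<in>A. c j *\<^sub>R f j) \<in> matching_space \<Phi>"
    by (intro subspace_sum[OF subspace_matching_space]) simp
  have i: "i \<in> insert i A" by simp
  have IH: "defect \<Phi> \<kappa> (\<Sum>j\<in>A. c j *\<^sub>R f j) = (\<Sum>j\<in>A. c j * defect \<Phi> \<kappa> (f j))"
    using insert.prems by (intro insert.IH) simp
  show ?case
    unfolding sum.insert[OF insert.hyps] defect_linear(1)[OF \<Phi> mem[OF i] sum]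
      defect_linear(2)[OF \<Phi> insert.prems[OF i]] IH by (rule refl)
qed

definition quad_pairing :: "('t \<Rightarrow> quad \<Rightarrow> real) \<Rightarrow> real ^ ('t::finite) ndisc \<Rightarrow> real" where
  "quad_pairing \<theta> s = (\<Sum>\<sigma>\<in>UNIV. \<Sum>q\<in>UNIV. \<theta> \<sigma> q * s $ Quad \<sigma> q)"

lemma quad_pairing_W_combination:
  assumes \<Phi>: "triangulated_pseudomanifold \<Phi>"
  shows "quad_pairing \<theta> (W_combination \<Phi> w z) =
    - (\<Sum>\<sigma>\<in>UNIV. w \<sigma> * (\<Sum>q\<in>UNIV. \<theta> \<sigma> q))
    - (\<Sum>e\<in>edges \<Phi>. z e * (\<Sum>(\<sigma>, E)\<in>e. \<theta> \<sigma> (facing_quad E)))"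
proof -
  let ?Z = "\<lambda>\<sigma> E. z (edge_class \<Phi> \<sigma> E)"
  have tet: "(\<Sum>q\<in>UNIV. \<theta> \<sigma> q * W_combination \<Phi> w z $ Quad \<sigma> q) =
    - (w \<sigma> * (\<Sum>q\<in>UNIV. \<theta> \<sigma> q)) - (\<Sum>E | card E = 2. ?Z \<sigma> E * \<theta> \<sigma> (facing_quad E))" for \<sigma>
  proof -
    have "(\<Sum>q\<in>UNIV. \<Sum>E\<in>quad_edges q. ?Z \<sigma> E * \<theta> \<sigma> q) =
      (\<Sum>q\<in>UNIV. \<Sum>E | card E = 2 \<and> facing_quad E = q. ?Z \<sigma> E * \<theta> \<sigma> (facing_quad E))"
      by (intro sum.cong refl) (auto simp: quad_edges_iff)
    also have "\<dots> = (\<Sum>E | card E = 2. ?Z \<sigma> E * \<theta> \<sigma> (facing_quad E))"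
      using sum.group[of "{E :: 4 set. card E = 2}" UNIV facing_quad "\<lambda>E. ?Z \<sigma> E * \<theta> \<sigma> (facing_quad E)"]
      by simp
    finally have *: "(\<Sum>q\<in>UNIV. \<Sum>E\<in>quad_edges q. ?Z \<sigma> E * \<theta> \<sigma> q) =
      (\<Sum>E | card E = 2. ?Z \<sigma> E * \<theta> \<sigma> (facing_quad E))" .
    have "(\<Sum>q\<in>UNIV. \<theta> \<sigma> q * W_combination \<Phi> w z $ Quad \<sigma> q) =
      (\<Sum>q\<in>UNIV. - (w \<sigma> * \<theta> \<sigma> q) - (\<Sum>E\<in>quad_edges q. ?Z \<sigma> E * \<theta> \<sigma> q))"
      unfolding W_combination_eq_local_combination[OF \<Phi>] local_combination_def
      by (intro sum.cong refl) (simp add: algebra_simps sum_distrib_left)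
    then show ?thesis by (simp only: sum_subtractf sum_negf sum_distrib_left *)
  qed
  have "(\<Sum>\<sigma>\<in>UNIV. \<Sum>E | card E = 2. ?Z \<sigma> E * \<theta> \<sigma> (facing_quad E)) =
    (\<Sum>e\<in>edges \<Phi>. \<Sum>p\<in>e. ?Z (fst p) (snd p) * \<theta> (fst p) (facing_quad (snd p)))"
    by (simp add: sum_edges[OF \<Phi>])
  also have "\<dots> = (\<Sum>e\<in>edges \<Phi>. \<Sum>p\<in>e. z e * \<theta> (fst p) (facing_quad (snd p)))"
    by (intro sum.cong refl) (simp add: edge_classI)
  also have "\<dots> = (\<Sum>e\<in>edges \<Phi>. z e * (\<Sum>(\<sigma>, E)\<in>e. \<theta> \<sigma> (facing_quad E)))"
    by (simp add: sum_distrib_left split_def)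
  finally show ?thesis unfolding quad_pairing_def tet by (simp add: sum_subtractf sum_negf)
qed

text \<open>
  The conditions on the right are the equation on the left at the basis vectors \<open>W\<^sub>\<sigma>\<close> and \<open>W\<^sub>e\<close>.
\<close>

lemma defect_eq_quad_pairing_iff:
  assumes \<Phi>: "triangulated_pseudomanifold \<Phi>"
  shows "(\<forall>s\<in>matching_space \<Phi>. defect \<Phi> \<kappa> s = - quad_pairing \<theta> s) \<longleftrightarrow>
    (\<forall>\<sigma>. (\<Sum>q\<in>UNIV. \<theta> \<sigma> q) = pi) \<and>
    (\<forall>e\<in>edges \<Phi>. (\<Sum>(\<sigma>, E)\<in>e. \<theta> \<sigma> (facing_quad E)) = prescribed_angle_sum \<Phi> \<kappa> e)"
    (is "?L \<longleftrightarrow> ?R")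
proof
  assume L: ?L
  have eq: "pi * (\<Sum>\<sigma>\<in>UNIV. w \<sigma>) + (\<Sum>e\<in>edges \<Phi>. z e * prescribed_angle_sum \<Phi> \<kappa> e) =
    (\<Sum>\<sigma>\<in>UNIV. w \<sigma> * (\<Sum>q\<in>UNIV. \<theta> \<sigma> q)) +
    (\<Sum>e\<in>edges \<Phi>. z e * (\<Sum>(\<sigma>, E)\<in>e. \<theta> \<sigma> (facing_quad E)))" for w z
    using bspec[OF L W_combination_in_matching_space[OF \<Phi>, of w z]]
    unfolding defect_W_combination[OF \<Phi>] quad_pairing_W_combination[OF \<Phi>] by simp
  have delta: "(\<Sum>i\<in>A. (if i = j then 1 else 0) * f i) = f j" if "j \<in> A" "finite A"
    for A and j :: 'b and f :: "'b \<Rightarrow> real"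
    using that by (simp add: if_distrib[of "\<lambda>x. x * _"] cong: if_cong)
  show ?R
  proof (intro conjI allI ballI)
    fix \<tau>
    show "(\<Sum>q\<in>UNIV. \<theta> \<tau> q) = pi"
      using eq[of "\<lambda>\<sigma>. if \<sigma> = \<tau> then 1 else 0" "\<lambda>_. 0"] by (simp add: delta)
  next
    fix e assume e: "e \<in> edges \<Phi>"
    show "(\<Sum>(\<sigma>, E)\<in>e. \<theta> \<sigma> (facing_quad E)) = prescribed_angle_sum \<Phi> \<kappa> e"
      using eq[of "\<lambda>_. 0" "\<lambda>e'. if e' = e then 1 else 0"] unfolding delta[OF e finite_edges] by simp
  qed
next
  assume R: ?R
  show ?L
  proof
    fix s assume "s \<in> matching_space \<Phi>"
    then obtain w z where s: "s = W_combination \<Phi> w z" using W_combination_exists[OF \<Phi>] by metis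
    show "defect \<Phi> \<kappa> s = - quad_pairing \<theta> s"
      unfolding s defect_W_combination[OF \<Phi>] quad_pairing_W_combination[OF \<Phi>]
      using R by (simp add: sum_distrib_left mult.commute)
  qed
qed

text \<open>
  Add the angle sums at \<open>a\<close> and \<open>b\<close> and subtract those at \<open>c\<close> and \<open>d\<close>: the four edges joining the two
  pairs cancel.
\<close>

lemma opposite_angles_eq:
  assumes "\<And>a. area \<alpha> \<sigma> a = 0" "distinct [a, b, c, d]"
  shows "\<alpha> (\<sigma>, {a, b}) = \<alpha> (\<sigma>, {c, d})"
proof -
  have d: "distinct [b, a, c, d]" "distinct [c, a, b, d]" "distinct [d, a, b, c]" using assms(2) by auto
  have *: "(\<Sum>E | card E = 2 \<and> x \<in> E. \<alpha> (\<sigma>, E)) = pi" for x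
    using assms(1)[of x] by (simp add: area_def)
  show ?thesis
    using *[of a] *[of b] *[of c] *[of d]
    unfolding sum_pairs_through[OF assms(2)] sum_pairs_through[OF d(1)] sum_pairs_through[OF d(2)]
      sum_pairs_through[OF d(3)]
    by (simp add: insert_commute)
qed

text \<open>
  Since opposite edges carry the same angle, an angle structure amounts to a positive function on
  quadrilateral types.  At each vertex of a tetrahedron meet three edges, one for each type, so
  zero area is the condition that the three angles of the tetrahedron add up to \<open>\<pi>\<close>.
\<close>

lemma angle_structure_iff:
  fixes \<Phi> :: "('t::finite) pairing set"
  assumes \<Phi>: "triangulated_pseudomanifold \<Phi>"
  shows "(\<exists>\<alpha>. angle_structure \<Phi> \<kappa> \<alpha>) \<longleftrightarrow>
    (\<exists>\<theta>. (\<forall>\<sigma> q. 0 < \<theta> \<sigma> q) \<and> (\<forall>s\<in>matching_space \<Phi>. defect \<Phi> \<kappa> s = - quad_pairing \<theta> s))"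
proof
  assume "\<exists>\<alpha>. angle_structure \<Phi> \<kappa> \<alpha>"
  then obtain \<alpha> where pos: "\<And>\<sigma> E. card E = 2 \<Longrightarrow> 0 < \<alpha> (\<sigma>, E)" and area: "\<And>\<sigma> a. area \<alpha> \<sigma> a = 0"
    and curv: "\<And>e. e \<in> edges \<Phi> \<Longrightarrow> curvature \<Phi> \<alpha> e = \<kappa> e"
    unfolding angle_structure_def by blast
  define \<theta> where "\<theta> \<sigma> q = (\<Sum>E\<in>quad_edges q. \<alpha> (\<sigma>, E)) / 2" for \<sigma> q
  have \<theta>: "\<theta> \<sigma> (facing_quad E) = \<alpha> (\<sigma>, E)" if E2: "card E = 2" for \<sigma> E
  proof -
    obtain a b c d where E: "E = {a, b}" and d: "distinct [a, b, c, d]" using E2 by (rule pair_labels)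
    have "{a, b} \<noteq> {c, d}" using d by auto
    then show ?thesis
      unfolding \<theta>_def E facing_quad_labels(3)[OF d] using opposite_angles_eq[OF area d, of \<sigma>] by simp
  qed
  have \<theta>_pos: "0 < \<theta> \<sigma> q" for \<sigma> q
  proof -
    obtain a b c d where q: "q = facing_quad {a, b}" and "distinct [a, b, c, d]" by (rule quad_labels)
    then have "card {a, b} = 2" by simp
    then show ?thesis using \<theta>[of "{a, b}" \<sigma>] pos[of "{a, b}" \<sigma>] q by simp
  qed
  have "(\<Sum>q\<in>UNIV. \<theta> \<sigma> q) = pi" for \<sigma>
  proof -
    have d: "distinct [1, 2, 3, 4 :: 4]" by simp
    show ?thesis
      unfolding sum_quads[OF d] using area[of \<sigma> 1] sum_pairs_through[OF d, of "\<lambda>E. \<alpha> (\<sigma>, E)"]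
      by (simp add: area_def \<theta>)
  qed
  moreover have "(\<Sum>(\<sigma>, E)\<in>e. \<theta> \<sigma> (facing_quad E)) = prescribed_angle_sum \<Phi> \<kappa> e" if e: "e \<in> edges \<Phi>" for e
  proof -
    have "(\<Sum>(\<sigma>, E)\<in>e. \<theta> \<sigma> (facing_quad E)) = (\<Sum>p\<in>e. \<alpha> p)"
      using card_edge_member[OF \<Phi> e] by (intro sum.cong refl) (auto simp: \<theta>)
    then show ?thesis using curv[OF e] by (simp add: curvature_def prescribed_angle_sum_def)
  qed
  ultimately have "\<forall>s\<in>matching_space \<Phi>. defect \<Phi> \<kappa> s = - quad_pairing \<theta> s"
    using defect_eq_quad_pairing_iff[OF \<Phi>] by blast
  then show "\<exists>\<theta>. (\<forall>\<sigma> q. 0 < \<theta> \<sigma> q) \<and> (\<forall>s\<in>matching_space \<Phi>. defect \<Phi> \<kappa> s = - quad_pairing \<theta> s)"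
    using \<theta>_pos by blast
next
  assume "\<exists>\<theta>. (\<forall>\<sigma> q. 0 < \<theta> \<sigma> q) \<and> (\<forall>s\<in>matching_space \<Phi>. defect \<Phi> \<kappa> s = - quad_pairing \<theta> s)"
  then obtain \<theta> where pos: "\<And>\<sigma> q. 0 < \<theta> \<sigma> q"
    and "\<forall>s\<in>matching_space \<Phi>. defect \<Phi> \<kappa> s = - quad_pairing \<theta> s" by blast
  then have tet: "\<And>\<sigma>. (\<Sum>q\<in>UNIV. \<theta> \<sigma> q) = pi"
    and edge: "\<And>e. e \<in> edges \<Phi> \<Longrightarrow> (\<Sum>(\<sigma>, E)\<in>e. \<theta> \<sigma> (facing_quad E)) = prescribed_angle_sum \<Phi> \<kappa> e"
    using defect_eq_quad_pairing_iff[OF \<Phi>, of \<kappa> \<theta>] by blast+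
  let ?\<alpha> = "\<lambda>(\<sigma>, E). \<theta> \<sigma> (facing_quad E)"
  have "area ?\<alpha> \<sigma> a = 0" for \<sigma> a
  proof -
    obtain b where "a \<noteq> b" by (metis zero_neq_one)
    then obtain c d where d: "distinct [a, b, c, d]" by (rule labels_extend)
    show ?thesis using tet[of \<sigma>] unfolding area_def sum_pairs_through[OF d] sum_quads[OF d] by simp
  qed
  moreover have "curvature \<Phi> ?\<alpha> e = \<kappa> e" if "e \<in> edges \<Phi>" for e
    using edge[OF that] by (simp add: curvature_def prescribed_angle_sum_def)
  ultimately have "angle_structure \<Phi> \<kappa> ?\<alpha>" using pos by (auto simp: angle_structure_def)
  then show "\<exists>\<alpha>. angle_structure \<Phi> \<kappa> \<alpha>" by blast
qed

section \<open>Positive angles from separation\<close>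

lemma compact_convex_standard_simplex:
  shows "compact {x :: real ^ 'n. (\<forall>i. 0 \<le> x $ i) \<and> (\<Sum>i\<in>UNIV. x $ i) = 1}" (is "compact ?D")
    and "convex {x :: real ^ 'n. (\<forall>i. 0 \<le> x $ i) \<and> (\<Sum>i\<in>UNIV. x $ i) = 1}"
proof -
  have "norm x \<le> 1" if "x \<in> ?D" for x
    using norm_le_l1_cart[of x] that by simp
  then have "bounded ?D" by (auto simp: bounded_iff)
  moreover have "closed ?D"
    by (intro closed_Collect_conj closed_Collect_all closed_Collect_le closed_Collect_eq continuous_intros)
  ultimately show "compact ?D" by (simp add: compact_eq_bounded_closed)
  show "convex ?D"
    by (rule convexI) (auto simp: sum.distrib simp flip: sum_distrib_left)
qed

text \<open>
  A Farkas-type argument.  The quadrilateral parts \<open>N\<close> of the solutions of zero defect form a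
  subspace disjoint from the simplex \<open>\<Delta>\<close>.  A functional that separates them vanishes on \<open>N\<close> and is
  positive at the corners of \<open>\<Delta>\<close>, so up to a positive factor it represents the negative of the defect.
\<close>

lemma positive_quad_angles:
  fixes \<Phi> :: "('t::finite) pairing set"
  assumes \<Phi>: "triangulated_pseudomanifold \<Phi>"
    and neg: "\<And>s. s \<in> matching_space \<Phi> \<Longrightarrow> \<forall>\<sigma> q. 0 \<le> s $ Quad \<sigma> q \<Longrightarrow> \<exists>\<sigma> q. 0 < s $ Quad \<sigma> q \<Longrightarrow>
      defect \<Phi> \<kappa> s < 0"
  shows "\<exists>\<theta>. (\<forall>\<sigma> q. 0 < \<theta> \<sigma> q) \<and> (\<forall>s\<in>matching_space \<Phi>. defect \<Phi> \<kappa> s = - quad_pairing \<theta> s)"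
proof -
  define Q :: "real ^ 't ndisc \<Rightarrow> real ^ ('t \<times> quad)" where "Q s = (\<chi> i. s $ Inl i)" for s
  define N where "N = Q ` {s \<in> matching_space \<Phi>. defect \<Phi> \<kappa> s = 0}"
  define \<Delta> where "\<Delta> = {x :: real ^ ('t \<times> quad). (\<forall>i. 0 \<le> x $ i) \<and> (\<Sum>i\<in>UNIV. x $ i) = 1}"
  have Q_linear: "linear Q" by (rule linearI) (simp_all add: Q_def vec_eq_iff)
  have "subspace {s \<in> matching_space \<Phi>. defect \<Phi> \<kappa> s = 0}"
  proof (rule subspaceI)
    have "0 \<in> matching_space \<Phi>" by (rule subspace_0[OF subspace_matching_space])
    then show "0 \<in> {s \<in> matching_space \<Phi>. defect \<Phi> \<kappa> s = 0}"
      using defect_linear(2)[OF \<Phi>, of 0 \<kappa> 0] by simp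
  qed (auto simp: defect_linear[OF \<Phi>] subspace_add[OF subspace_matching_space]
      subspace_scale[OF subspace_matching_space])
  then have N: "subspace N" unfolding N_def by (rule linear_subspace_image[OF Q_linear])
  have axis_D: "axis i 1 \<in> \<Delta>" for i by (auto simp: \<Delta>_def axis_def)
  have "N \<inter> \<Delta> = {}"
  proof (rule ccontr)
    assume "N \<inter> \<Delta> \<noteq> {}"
    then obtain s where s: "s \<in> matching_space \<Phi>" "defect \<Phi> \<kappa> s = 0" "Q s \<in> \<Delta>"
      by (auto simp: N_def)
    have nonneg: "0 \<le> s $ Quad \<sigma> q" for \<sigma> q using s(3) by (simp add: \<Delta>_def Q_def)
    have "(\<Sum>i\<in>UNIV. s $ Inl i) = 1" using s(3) by (simp add: \<Delta>_def Q_def)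
    then obtain i where "s $ Inl i \<noteq> 0" by (metis sum.neutral zero_neq_one)
    then have "0 < s $ Quad (fst i) (snd i)" using nonneg[of "fst i" "snd i"] by simp
    then have "defect \<Phi> \<kappa> s < 0" using nonneg by (intro neg[OF s(1)]) blast+
    then show False using s(2) by simp
  qed
  moreover have "\<Delta> \<noteq> {}" using axis_D by blast
  moreover have "compact \<Delta>" "convex \<Delta>" unfolding \<Delta>_def by (rule compact_convex_standard_simplex)+
  ultimately have "\<exists>a b. (\<forall>x\<in>N. a \<bullet> x < b) \<and> (\<forall>x\<in>\<Delta>. b < a \<bullet> x)"
    by (intro separating_hyperplane_closed_compact subspace_imp_convex[OF N] closed_subspace[OF N])
  then obtain a b where aN: "\<And>x. x \<in> N \<Longrightarrow> a \<bullet> x < b" and aD: "\<And>x. x \<in> \<Delta> \<Longrightarrow> b < a \<bullet> x"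
    by blast
  \<comment> \<open>A functional bounded above on a subspace vanishes on it.\<close>
  have b: "0 < b" using aN[OF subspace_0[OF N]] by simp
  have a0: "a \<bullet> x = 0" if "x \<in> N" for x
  proof (rule ccontr)
    assume "a \<bullet> x \<noteq> 0"
    then have "a \<bullet> ((b / (a \<bullet> x)) *\<^sub>R x) = b" by simp
    then show False using aN[OF subspace_scale[OF N that, of "b / (a \<bullet> x)"]] by simp
  qed
  have a_pos: "0 < a $ i" for i
    using aD[OF axis_D[of i]] b by (simp add: inner_axis)
  \<comment> \<open>A vector with defect \<open>- 1\<close>, used to correct any solution to one of zero defect.\<close>
  obtain \<tau> :: 't where True by blast
  define s0 where "s0 = W_combination \<Phi> (\<lambda>\<sigma>. if \<sigma> = \<tau> then - 1 / pi else 0) (\<lambda>_. 0)"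
  have s0: "s0 \<in> matching_space \<Phi>" unfolding s0_def by (rule W_combination_in_matching_space[OF \<Phi>])
  have defect_s0: "defect \<Phi> \<kappa> s0 = - 1"
    unfolding s0_def defect_W_combination[OF \<Phi>] by simp
  have inner_Q: "a \<bullet> Q s = quad_pairing (\<lambda>\<sigma> q. a $ (\<sigma>, q)) s" for s
    unfolding quad_pairing_def sum.cartesian_product UNIV_Times_UNIV
    by (simp add: inner_vec_def Q_def split_def)
  define k where "k = a \<bullet> Q s0"
  have "k = (\<Sum>q\<in>UNIV. a $ (\<tau>, q)) / pi"
    unfolding k_def inner_Q s0_def quad_pairing_W_combination[OF \<Phi>]
    by (simp add: if_distrib[of "\<lambda>x. x * _"] sum_negf[symmetric] cong: if_cong)
  then have k: "0 < k" using a_pos by (simp add: sum_pos)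
  define \<theta> where "\<theta> \<sigma> q = a $ (\<sigma>, q) / k" for \<sigma> q
  have "defect \<Phi> \<kappa> s = - quad_pairing \<theta> s" if s: "s \<in> matching_space \<Phi>" for s
  proof -
    let ?r = "defect \<Phi> \<kappa> s"
    have r: "?r *\<^sub>R s0 \<in> matching_space \<Phi>" by (rule subspace_scale[OF subspace_matching_space s0])
    have "defect \<Phi> \<kappa> (s + ?r *\<^sub>R s0) = 0"
      by (simp add: defect_linear(1)[OF \<Phi> s r] defect_linear(2)[OF \<Phi> s0] defect_s0)
    then have "Q (s + ?r *\<^sub>R s0) \<in> N"
      unfolding N_def using subspace_add[OF subspace_matching_space s r] by blast
    then have "a \<bullet> Q (s + ?r *\<^sub>R s0) = 0" by (rule a0)
    then have "a \<bullet> Q s + ?r * k = 0"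
      by (simp add: linear_add[OF Q_linear] linear_scale[OF Q_linear] inner_add_right k_def)
    then have "?r = - (a \<bullet> Q s / k)" using k by (simp add: field_simps)
    also have "a \<bullet> Q s / k = quad_pairing \<theta> s"
      unfolding inner_Q by (simp add: quad_pairing_def \<theta>_def sum_divide_distrib)
    finally show ?thesis by simp
  qed
  moreover have "0 < \<theta> \<sigma> q" for \<sigma> q using a_pos k by (simp add: \<theta>_def)
  ultimately show ?thesis by blast
qed

section \<open>Solutions without quadrilaterals\<close>

lemma normal_coordinate_components:
  "normal_coordinate (vertex_link v) $ Quad \<sigma> q = 0"
  "normal_coordinate (vertex_link v) $ Tri \<sigma> a = of_bool ((\<sigma>, {a}) \<in> v)"
proof -
  show "normal_coordinate (vertex_link v) $ Quad \<sigma> q = 0"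
    unfolding normal_coordinate_def sum_component by (rule sum.neutral) (auto simp: axis_def)
  have "normal_coordinate (vertex_link v) $ Tri \<sigma> a = (\<Sum>p\<in>vertex_link v. if p = (\<sigma>, a) then 1 else 0)"
    unfolding normal_coordinate_def sum_component by (intro sum.cong) (auto simp: axis_def)
  then show "normal_coordinate (vertex_link v) $ Tri \<sigma> a = of_bool ((\<sigma>, {a}) \<in> v)"
    by (simp add: vertex_link_def)
qed

lemma mem_vertex_iff:
  assumes "v \<in> vertices \<Phi>"
  shows "p \<in> v \<longleftrightarrow> v = cell_ident \<Phi> `` {p}"
proof -
  obtain p' where v: "v = cell_ident \<Phi> `` {p'}" using assms unfolding vertices_def by (rule quotientE)
  have "p \<in> cell_ident \<Phi> `` {p}" by (simp add: cell_ident_def)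
  then show ?thesis unfolding v using equiv_class_eq_iff[OF equiv_cell_ident, of p' p \<Phi>] by auto
qed

lemma normal_coordinate_in_matching_space:
  assumes "v \<in> vertices \<Phi>"
  shows "normal_coordinate (vertex_link v) \<in> matching_space \<Phi>"
  unfolding matching_space_def
proof (intro CollectI ballI allI impI)
  fix \<phi> a assume "\<phi> \<in> \<Phi>" "a \<noteq> opp_dom \<phi>"
  then have "((tet_dom \<phi>, {a}), (tet_cod \<phi>, {vmap \<phi> a})) \<in> cell_glue \<Phi>"
    by (force simp: cell_glue_def)
  then have "((tet_dom \<phi>, {a}), (tet_cod \<phi>, {vmap \<phi> a})) \<in> cell_ident \<Phi>"
    by (auto simp: cell_ident_def)
  then have "(tet_dom \<phi>, {a}) \<in> v \<longleftrightarrow> (tet_cod \<phi>, {vmap \<phi> a}) \<in> v"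
    unfolding mem_vertex_iff[OF assms] using equiv_class_eq[OF equiv_cell_ident] by metis
  then show "normal_coordinate (vertex_link v) $ Quad (tet_dom \<phi>) (facing_quad {opp_dom \<phi>, a}) +
      normal_coordinate (vertex_link v) $ Tri (tet_dom \<phi>) a =
      normal_coordinate (vertex_link v) $ Quad (tet_cod \<phi>) (facing_quad {vmap \<phi> (opp_dom \<phi>), vmap \<phi> a}) +
      normal_coordinate (vertex_link v) $ Tri (tet_cod \<phi>) (vmap \<phi> a)"
    by (simp add: normal_coordinate_components)
qed

text \<open>
  Without quadrilaterals the matching equations say that glued corners carry the same triangle
  coordinate, so that it depends only on the vertex of the triangulation.
\<close>

lemma vertex_link_decomposition:
  fixes \<Phi> :: "('t::finite) pairing set"
  assumes \<Phi>: "triangulated_pseudomanifold \<Phi>"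
    and s: "s \<in> matching_space \<Phi>" and zero: "\<And>\<sigma> q. s $ Quad \<sigma> q = 0"
  obtains c where "s = (\<Sum>v\<in>vertices \<Phi>. c v *\<^sub>R normal_coordinate (vertex_link v))"
proof -
  \<comment> \<open>The triangle coordinates as a function on all cells, to be followed along chains of gluings;
    the value at cells other than vertices is arbitrary but constant.\<close>
  define y where "y = (\<lambda>(\<sigma>, S). if card S = 1 then s $ Tri \<sigma> (the_elem S) else 0)"
  have y_glue: "y p = y q" if glue: "(p, q) \<in> cell_glue \<Phi>" for p q
  proof -
    obtain \<phi> S where pq: "\<phi> \<in> \<Phi>" "opp_dom \<phi> \<notin> S" "p = (tet_dom \<phi>, S)" "q = (tet_cod \<phi>, vmap \<phi> ` S)"
      using glue by (auto simp: cell_glue_def)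
    have card: "card (vmap \<phi> ` S) = card S" by (rule card_image[OF pseudomanifold_inj[OF \<Phi> pq(1)]])
    show ?thesis
    proof (cases "card S = 1")
      case True
      then obtain a where a: "S = {a}" by (rule card_1_singletonE)
      then have "a \<noteq> opp_dom \<phi>" using pq(2) by auto
      then have "s $ Tri (tet_dom \<phi>) a = s $ Tri (tet_cod \<phi>) (vmap \<phi> a)"
        using s pq(1) by (auto simp: matching_space_def zero)
      then show ?thesis by (simp add: y_def pq a)
    next
      case False
      then show ?thesis using card by (simp add: y_def pq)
    qed
  qed
  define c where "c v = y (SOME p. p \<in> v)" for v
  have c: "c v = s $ Tri \<sigma> a" if "v \<in> vertices \<Phi>" "(\<sigma>, {a}) \<in> v" for v \<sigma> a
  proof -
    have "(SOME p. p \<in> v) \<in> v" using that(2) by (rule someI)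
    then have "((\<sigma>, {a}), SOME p. p \<in> v) \<in> cell_ident \<Phi>"
      using mem_vertex_iff[OF that(1), of "(\<sigma>, {a})"] that(2) by auto
    then have "y (\<sigma>, {a}) = y (SOME p. p \<in> v)"
      unfolding cell_ident_def by (rule symcl_rtrancl_invariant) (rule y_glue)
    then show ?thesis by (simp add: c_def y_def)
  qed
  have "s = (\<Sum>v\<in>vertices \<Phi>. c v *\<^sub>R normal_coordinate (vertex_link v))"
  proof (rule vec_eq_iff[THEN iffD2], intro allI)
    fix i
    show "s $ i = (\<Sum>v\<in>vertices \<Phi>. c v *\<^sub>R normal_coordinate (vertex_link v)) $ i"
    proof (cases i)
      case (Inl p)
      then show ?thesis using zero by (cases p) (simp add: normal_coordinate_components)
    next
      case (Inr p)
      obtain \<sigma> a where p: "p = (\<sigma>, a)" by (cases p)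
      let ?v = "cell_ident \<Phi> `` {(\<sigma>, {a})}"
      have v: "?v \<in> vertices \<Phi>" unfolding vertices_def by (rule quotientI) simp
      have "(\<Sum>v\<in>vertices \<Phi>. c v * of_bool ((\<sigma>, {a}) \<in> v)) = (\<Sum>v\<in>vertices \<Phi>. if v = ?v then c v else 0)"
        by (rule sum.cong) (simp_all add: mem_vertex_iff[where \<Phi> = \<Phi>])
      also have "\<dots> = c ?v" using v by (simp add: sum.delta)
      also have "\<dots> = s $ Tri \<sigma> a" using v by (rule c) (simp add: cell_ident_def)
      finally show ?thesis by (simp add: Inr p normal_coordinate_components)
    qed
  qed
  then show thesis by (rule that)
qed

section \<open>Reduction to the polytope and its vertices\<close>

lemma euler_char_eq_iff_defect:
  assumes "triangulated_pseudomanifold \<Phi>" "v \<in> vertices \<Phi>"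
  shows "real_of_int (euler_char \<Phi> (vertex_link v)) = chi_curv \<Phi> \<kappa> (normal_coordinate (vertex_link v)) \<longleftrightarrow>
    defect \<Phi> \<kappa> (normal_coordinate (vertex_link v)) = 0"
  by (simp add: euler_char_vertex_link[OF assms] defect_def)

lemma defect_neg_iff: "defect \<Phi> \<kappa> s < 0 \<longleftrightarrow> chi_star \<Phi> s < chi_curv \<Phi> \<kappa> s"
  by (simp add: defect_def mult_less_0_iff)

lemma defect_eq_0_if_no_quads:
  assumes \<Phi>: "triangulated_pseudomanifold \<Phi>"
    and links: "\<And>v. v \<in> vertices \<Phi> \<Longrightarrow> defect \<Phi> \<kappa> (normal_coordinate (vertex_link v)) = 0"
    and s: "s \<in> matching_space \<Phi>" "\<And>\<sigma> q. s $ Quad \<sigma> q = 0"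
  shows "defect \<Phi> \<kappa> s = 0"
proof -
  obtain c where c: "s = (\<Sum>v\<in>vertices \<Phi>. c v *\<^sub>R normal_coordinate (vertex_link v))"
    using vertex_link_decomposition[OF \<Phi> s] .
  show ?thesis
    unfolding c
    by (subst defect_sum[OF \<Phi>]) (simp_all add: links normal_coordinate_in_matching_space)
qed

lemma quad_pairing_pos:
  assumes pos: "\<And>\<sigma> q. 0 < \<theta> \<sigma> q" and s: "\<And>\<sigma> q. 0 \<le> s $ Quad \<sigma> q" "0 < s $ Quad \<tau> r"
  shows "0 < quad_pairing \<theta> s"
proof -
  have nonneg: "0 \<le> \<theta> \<sigma> q * s $ Quad \<sigma> q" for \<sigma> q
    using pos[of \<sigma> q] s(1)[of \<sigma> q] by simp
  have "0 < (\<Sum>q\<in>UNIV. \<theta> \<tau> q * s $ Quad \<tau> q)"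
    by (rule sum_pos2[of _ r]) (simp_all add: nonneg pos s(2))
  then show ?thesis
    unfolding quad_pairing_def by (intro sum_pos2[of _ \<tau>]) (simp_all add: nonneg sum_nonneg)
qed

text \<open>
  Adding a large multiple of all vertex links together makes the triangle coordinates non-negative
  and changes neither the defect nor the quadrilateral coordinates; then scale to coordinate sum 1.
\<close>

lemma defect_neg_of_projective:
  assumes \<Phi>: "triangulated_pseudomanifold \<Phi>"
    and links: "\<And>v. v \<in> vertices \<Phi> \<Longrightarrow> defect \<Phi> \<kappa> (normal_coordinate (vertex_link v)) = 0"
    and proj: "\<And>s. s \<in> projective_solutions \<Phi> \<Longrightarrow> \<exists>\<sigma> q. 0 < s $ Quad \<sigma> q \<Longrightarrow> defect \<Phi> \<kappa> s < 0"
    and s: "s \<in> matching_space \<Phi>" "\<And>\<sigma> q. 0 \<le> s $ Quad \<sigma> q" "0 < s $ Quad \<tau> r"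
  shows "defect \<Phi> \<kappa> s < 0"
proof -
  \<comment> \<open>One triangle of each type: the sum of all vertex links.\<close>
  define T :: "real ^ 'a ndisc" where "T = (\<chi> i. case i of Inl _ \<Rightarrow> 0 | Inr _ \<Rightarrow> 1)"
  have T: "T \<in> matching_space \<Phi>" by (simp add: T_def matching_space_def)
  have defect_T: "defect \<Phi> \<kappa> T = 0"
    by (rule defect_eq_0_if_no_quads[OF \<Phi> _ T]) (simp_all add: links T_def)
  define m where "m = (\<Sum>i\<in>UNIV. \<bar>s $ i\<bar>)"
  define x where "x = s + m *\<^sub>R T"
  have abs_le: "\<bar>s $ i\<bar> \<le> m" for i unfolding m_def by (rule member_le_sum) auto
  have "0 \<le> s $ i + m" for i using abs_le[of i] by linarith
  then have x_nonneg: "0 \<le> x $ i" for i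
    using s(2) by (cases i) (auto simp: x_def T_def)
  have x_quad: "x $ Quad \<sigma> q = s $ Quad \<sigma> q" for \<sigma> q by (simp add: x_def T_def)
  have mT: "m *\<^sub>R T \<in> matching_space \<Phi>" by (rule subspace_scale[OF subspace_matching_space T])
  have x: "x \<in> matching_space \<Phi>" unfolding x_def by (rule subspace_add[OF subspace_matching_space s(1) mT])
  define t where "t = (\<Sum>i\<in>UNIV. x $ i)"
  have t: "0 < t"
    unfolding t_def by (rule sum_pos2[of _ "Quad \<tau> r"]) (simp_all add: x_nonneg x_quad s(3))
  have "(1 / t) *\<^sub>R x \<in> projective_solutions \<Phi>"
    using subspace_scale[OF subspace_matching_space x, of "1 / t"] x_nonneg t
    by (simp add: projective_solutions_def t_def flip: sum_divide_distrib)
  moreover have "0 < ((1 / t) *\<^sub>R x) $ Quad \<tau> r" using t s(3) by (simp add: x_quad)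
  ultimately have "defect \<Phi> \<kappa> ((1 / t) *\<^sub>R x) < 0" by (intro proj) blast+
  then have "defect \<Phi> \<kappa> x < 0"
    using t by (simp add: defect_linear(2)[OF \<Phi> x] divide_less_0_iff)
  then show ?thesis
    by (simp add: x_def defect_linear(1)[OF \<Phi> s(1) mT] defect_linear(2)[OF \<Phi> T] defect_T)
qed

lemma projective_solutions_hull:
  fixes \<Phi> :: "('t::finite) pairing set"
  shows "projective_solutions \<Phi> = convex hull vertex_solutions \<Phi>"
proof -
  have "compact (projective_solutions \<Phi>)"
    unfolding projective_solutions_def
    by (intro closed_Int_compact closed_subspace subspace_matching_space compact_convex_standard_simplex)
  moreover have "convex (projective_solutions \<Phi>)"
    unfolding projective_solutions_def
    by (intro convex_Int subspace_imp_convex subspace_matching_space compact_convex_standard_simplex)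
  ultimately show ?thesis unfolding vertex_solutions_def by (rule Krein_Milman_Minkowski)
qed

text \<open>
  The set \<open>K\<close> below is convex and contains all vertex solutions: those without quadrilaterals have
  defect 0.  The weak inequality in \<open>K\<close> is what lets a strictly negative summand win in a convex
  combination.
\<close>

lemma defect_neg_of_vertex_solutions:
  assumes \<Phi>: "triangulated_pseudomanifold \<Phi>"
    and links: "\<And>v. v \<in> vertices \<Phi> \<Longrightarrow> defect \<Phi> \<kappa> (normal_coordinate (vertex_link v)) = 0"
    and vert: "\<And>V. V \<in> vertex_solutions \<Phi> \<Longrightarrow> \<exists>\<sigma> q. 0 < V $ Quad \<sigma> q \<Longrightarrow> defect \<Phi> \<kappa> V < 0"
    and s: "s \<in> projective_solutions \<Phi>" "0 < s $ Quad \<tau> r"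
  shows "defect \<Phi> \<kappa> s < 0"
proof -
  define K where "K = {s \<in> matching_space \<Phi>. (\<forall>\<sigma> q. 0 \<le> s $ Quad \<sigma> q) \<and> defect \<Phi> \<kappa> s \<le> 0 \<and>
    ((\<exists>\<sigma> q. 0 < s $ Quad \<sigma> q) \<longrightarrow> defect \<Phi> \<kappa> s < 0)}"
  have "convex K"
  proof (rule convexI)
    fix x y and u v :: real
    assume x: "x \<in> K" and y: "y \<in> K" and uv: "0 \<le> u" "0 \<le> v" "u + v = 1"
    have ux: "u *\<^sub>R x \<in> matching_space \<Phi>" and vy: "v *\<^sub>R y \<in> matching_space \<Phi>"
      using x y by (auto simp: K_def intro: subspace_scale[OF subspace_matching_space])
    have eq: "defect \<Phi> \<kappa> (u *\<^sub>R x + v *\<^sub>R y) = u * defect \<Phi> \<kappa> x + v * defect \<Phi> \<kappa> y"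
      using x y by (simp add: K_def defect_linear(1)[OF \<Phi> ux vy] defect_linear(2)[OF \<Phi>])
    have le: "u * defect \<Phi> \<kappa> x \<le> 0" "v * defect \<Phi> \<kappa> y \<le> 0"
      using x y uv by (simp_all add: K_def mult_nonneg_nonpos)
    have "defect \<Phi> \<kappa> (u *\<^sub>R x + v *\<^sub>R y) < 0" if "0 < (u *\<^sub>R x + v *\<^sub>R y) $ Quad \<sigma> q" for \<sigma> q
    proof -
      have "0 < u * x $ Quad \<sigma> q \<or> 0 < v * y $ Quad \<sigma> q" using that by (auto simp: not_less)
      then have "u * defect \<Phi> \<kappa> x < 0 \<or> v * defect \<Phi> \<kappa> y < 0"
        using x y uv by (auto simp: K_def zero_less_mult_iff mult_less_0_iff)
      then show ?thesis unfolding eq using le by linarith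
    qed
    moreover have "0 \<le> (u *\<^sub>R x + v *\<^sub>R y) $ Quad \<sigma> q" for \<sigma> q
      using x y uv by (simp add: K_def)
    moreover have "defect \<Phi> \<kappa> (u *\<^sub>R x + v *\<^sub>R y) \<le> 0" unfolding eq using le by linarith
    ultimately show "u *\<^sub>R x + v *\<^sub>R y \<in> K"
      using subspace_add[OF subspace_matching_space ux vy] unfolding K_def by blast
  qed
  moreover have "vertex_solutions \<Phi> \<subseteq> K"
  proof
    fix V assume V: "V \<in> vertex_solutions \<Phi>"
    then have "V \<in> projective_solutions \<Phi>" by (simp add: vertex_solutions_def extreme_point_of_def)
    then have C: "V \<in> matching_space \<Phi>" and nonneg: "\<And>\<sigma> q. 0 \<le> V $ Quad \<sigma> q"
      by (auto simp: projective_solutions_def)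
    show "V \<in> K"
    proof (cases "\<exists>\<sigma> q. 0 < V $ Quad \<sigma> q")
      case True
      then show ?thesis using vert[OF V True] C nonneg by (simp add: K_def)
    next
      case False
      then have "\<not> 0 < V $ Quad \<sigma> q" for \<sigma> q by blast
      then have "V $ Quad \<sigma> q = 0" for \<sigma> q using nonneg[of \<sigma> q] by (simp add: order.order_iff_strict)
      then have "defect \<Phi> \<kappa> V = 0" by (intro defect_eq_0_if_no_quads[OF \<Phi> _ C]) (simp_all add: links)
      then show ?thesis using False C nonneg by (simp add: K_def)
    qed
  qed
  ultimately have "projective_solutions \<Phi> \<subseteq> K"
    unfolding projective_solutions_hull by (simp add: hull_minimal)
  then show ?thesis using s by (auto simp: K_def)
qed

theorem corollary20:
  fixes \<Phi> :: "('t::finite) pairing set"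
    and \<kappa> :: "('t \<times> 4 set) set \<Rightarrow> real"
  assumes "triangulated_pseudomanifold \<Phi>"
  shows
    "((\<exists>\<alpha>. angle_structure \<Phi> \<kappa> \<alpha>) \<longleftrightarrow>
       (\<forall>s\<in>matching_space \<Phi>.
          (\<forall>\<sigma> q. 0 \<le> s $ Quad \<sigma> q) \<and> (\<exists>\<sigma> q. 0 < s $ Quad \<sigma> q) \<longrightarrow>
          chi_star \<Phi> s < chi_curv \<Phi> \<kappa> s)) \<and>
     ((\<exists>\<alpha>. angle_structure \<Phi> \<kappa> \<alpha>) \<longleftrightarrow>
       (\<forall>v\<in>vertices \<Phi>. real_of_int (euler_char \<Phi> (vertex_link v)) =
          chi_curv \<Phi> \<kappa> (normal_coordinate (vertex_link v))) \<and>
       (\<forall>s\<in>projective_solutions \<Phi>.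
          (\<exists>\<sigma> q. 0 < s $ Quad \<sigma> q) \<longrightarrow> chi_star \<Phi> s < chi_curv \<Phi> \<kappa> s)) \<and>
     ((\<exists>\<alpha>. angle_structure \<Phi> \<kappa> \<alpha>) \<longleftrightarrow>
       (\<forall>v\<in>vertices \<Phi>. real_of_int (euler_char \<Phi> (vertex_link v)) =
          chi_curv \<Phi> \<kappa> (normal_coordinate (vertex_link v))) \<and>
       (\<forall>V\<in>vertex_solutions \<Phi>.
          (\<exists>\<sigma> q. 0 < V $ Quad \<sigma> q) \<longrightarrow> chi_star \<Phi> V < chi_curv \<Phi> \<kappa> V))"
    (is "(?A \<longleftrightarrow> ?all) \<and> (?A \<longleftrightarrow> ?links \<and> ?proj) \<and> (?A \<longleftrightarrow> ?links \<and> ?vert)")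
proof -
  note \<Phi> = assms
  have links: "?links \<longleftrightarrow> (\<forall>v\<in>vertices \<Phi>. defect \<Phi> \<kappa> (normal_coordinate (vertex_link v)) = 0)"
    by (rule ball_cong) (simp_all add: euler_char_eq_iff_defect[OF \<Phi>])
  have A_all: "?all" and A_links: "?links" if A: ?A
  proof -
    obtain \<theta> where pos: "\<And>\<sigma> q. 0 < \<theta> \<sigma> q"
      and \<theta>: "\<And>s. s \<in> matching_space \<Phi> \<Longrightarrow> defect \<Phi> \<kappa> s = - quad_pairing \<theta> s"
      using A unfolding angle_structure_iff[OF \<Phi>] by blast
    show ?all
      unfolding defect_neg_iff[symmetric] using \<theta> quad_pairing_pos[of \<theta>, OF pos] by auto
    show ?links
      unfolding links
      by (simp add: \<theta> normal_coordinate_in_matching_space quad_pairing_def normal_coordinate_components)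
  qed
  have all_A: ?A if all: ?all
    unfolding angle_structure_iff[OF \<Phi>]
    by (rule positive_quad_angles[OF \<Phi>]) (use all in \<open>auto simp: defect_neg_iff\<close>)
  have all_proj: ?proj if all: ?all
  proof (intro ballI impI)
    fix s assume "s \<in> projective_solutions \<Phi>" "\<exists>\<sigma> q. 0 < s $ Quad \<sigma> q"
    then show "chi_star \<Phi> s < chi_curv \<Phi> \<kappa> s"
      using all by (auto simp: projective_solutions_def)
  qed
  have proj_vert: ?vert if ?proj
    using that by (auto simp: vertex_solutions_def extreme_point_of_def)
  have proj_all: ?all if l: ?links and p: ?proj
  proof (intro ballI impI, elim conjE exE)
    fix s \<tau> r assume s: "s \<in> matching_space \<Phi>" "\<forall>\<sigma> q. 0 \<le> s $ Quad \<sigma> q" "0 < s $ Quad \<tau> r"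
    have "defect \<Phi> \<kappa> s < 0"
      by (rule defect_neg_of_projective[OF \<Phi> _ _ s(1) _ s(3)])
        (use l[unfolded links] p s(2) in \<open>auto simp: defect_neg_iff\<close>)
    then show "chi_star \<Phi> s < chi_curv \<Phi> \<kappa> s" by (simp add: defect_neg_iff)
  qed
  have vert_proj: ?proj if l: ?links and v: ?vert
  proof (intro ballI impI, elim exE)
    fix s \<tau> r assume s: "s \<in> projective_solutions \<Phi>" "0 < s $ Quad \<tau> r"
    have "defect \<Phi> \<kappa> s < 0"
      by (rule defect_neg_of_vertex_solutions[OF \<Phi> _ _ s])
        (use l[unfolded links] v in \<open>auto simp: defect_neg_iff\<close>)
    then show "chi_star \<Phi> s < chi_curv \<Phi> \<kappa> s" by (simp add: defect_neg_iff)
  qed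
  show ?thesis
  proof (intro conjI)
    show "?A \<longleftrightarrow> ?all" using A_all all_A by (rule iffI)
    show "?A \<longleftrightarrow> ?links \<and> ?proj" using A_all A_links all_A all_proj proj_all by iprover
    show "?A \<longleftrightarrow> ?links \<and> ?vert"
      using A_all A_links all_A all_proj proj_all proj_vert vert_proj by iprover
  qed
qed

end
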